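(* Let $\Omega\subset\mathbb{R}^2$ be the interior of a simple polygon, let $\mathscr{T}$ be a triangulation of $\overline\Omega$ with vertices $V$, boundary vertices $V_B$ and edges $E$, and let $(V,E,V_B,\gamma)$, $\gamma:E\to\mathbb{R}$, be a resistor network on this graph such that $0$ is not a Dirichlet eigenvalue (i.e. $\tilde L(\gamma)$ is invertible). For each interior edge $e\in E_I$ fix one of its two orientations $e'$. For every function $\alpha:E_I\to\mathbb{R}$ there is a symmetric matrix function $\sigma_\alpha\in PC(\mathscr{T})$ satisfying the splitting conditions (b) if $e=\{x_j,x_k\}\in E_I$, and $T,T'$ are the two triangles of $\mathscr{T}$ containing $e$, where $\partial T$ has the same orientation as $e'$ and $\partial T'$ the opposite one, then $$\int_T\sigma_\alpha\nabla v_j\cdot\nabla v_k\,dx=-\tfrac12\gamma_{jk}-\alpha(e),\qquad \int_{T'}\sigma_\alpha\nabla v_j\cdot\nabla v_k\,dx=-\tfrac12\gamma_{jk}+\alpha(e);$$ (c) if $e=\{x_j,x_k\}\in E_B$ and $T$ is the unique triangle of $\mathscr{T}$ containing $e$, then $\int_T\sigma_\alpha\nabla v_j\cdot\nabla v_k\,dx=-\gamma_{jk}$; and such that $L(\sigma_\alpha)=\tilde L(\gamma)$ and $\Lambda^{\mathrm{FEM}}_{\sigma_\alpha}=\Lambda_\gamma$. Moreover, any $\sigma\in PC(\mathscr{T})$ that satisfies $L(\sigma)=\tilde L(\gamma)$ and $\Lambda^{\mathrm{FEM}}_\sigma=\Lambda_\gamma$ is of the form $\sigma=\sigma_\alpha$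 for some such function $\alpha$.
   Context: Triangulation: a finite set $\mathscr{T}$ of closed (nondegenerate) triangles in $\mathbb{R}^2$ with union $\overline\Omega$, such that two distinct triangles are either disjoint or meet in exactly one common vertex or one full common edge. $V=\{x_1,\dots,x_N\}$ is the set of all vertices, labeled so that $V_B=\{x_1,\dots,x_B\}=V\cap\partial\Omega$. $E$ is the set of unordered pairs $\{x_j,x_k\}$ that are sides of triangles of $\mathscr{T}$; $E_I$ (interior edges) consists of the edges belonging to exactly two triangles, $E_B$ (boundary edges) of those belonging to only one triangle. Triangles are oriented counterclockwise; "$\partial T$ has the same orientation as the directed edge $(x,y)$" means that the counterclockwise traversal of $\partial T$ goes along that side from $x$ to $y$. $PC(\mathscr{T})$ is the set of $\sigma\in L^\infty(\Omega;\mathbb{R}^{2\times2})$ that are equal to a constant symmetric matrix (not necessarily positive) in the interior of each triangle. FEM model: $v_k:\overline\Omega\to\mathbb{R}$ is the continuous function, affine on each triangle, with $v_k(x_k)=1$ and $v_k(x_j)=0$ for $j\ne k$. $L(\sigma)=(l_{jk})_{j,k=1}^N$ has $l_{jk}=\delta_{jk}$ for $1\le j\le B$ and $l_{jk}=\int_\Omega\sigma\nabla v_j\cdot\nabla v_k\,dx$ for $B+1\le j\le N$. If $L(\sigma)$ is invertible, $\Lambda_\sigma^{\mathrm{FEM}}:\mathbb{R}^B\to\mathbb{R}^B$ is $(\Lambda_\sigma^{\mathrm{FEM}}f)_j=\sum_{k=1}^N\big(\int_\Omega\sigma\nabla v_j\cdot\nabla v_k\,dx\big)u_k$, $1\le j\le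 B$, where $L(\sigma)u=(f,0)^t$. Resistor network: write $\gamma_{jk}=\gamma(\{x_j,x_k\})$, with $\gamma_{jk}=0$ if $\{x_j,x_k\}\notin E$. $\tilde L(\gamma)=(\tilde l_{jk})_{j,k=1}^N$ has $\tilde l_{jk}=\delta_{jk}$ for $j\le B$; for $j\ge B+1$, $\tilde l_{jj}=\sum_{k\neq j}\gamma_{jk}$ and $\tilde l_{jk}=-\gamma_{jk}$ for $k\ne j$. If $\tilde L(\gamma)$ is invertible, $(\Lambda_\gamma f)_j=\sum_{k\ne j}\gamma_{jk}(u_j-u_k)$, $1\le j\le B$, where $\tilde L(\gamma)u=(f,0)^t$. *)

theory Defs
  imports "HOL-Analysis.Analysis" "Jordan_Normal_Form.Matrix"
begin

(* The dollar sign is kept for the components of Jordan_Normal_Form vectors. *)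
no_notation Finite_Cartesian_Product.vec_nth (infixl "$" 90)


section \<open>Polygons and triangulations\<close>

text \<open>The path through the listed points. Its image is the boundary of a simple polygon when the
  path is simple and closed, so the first point of the list is repeated at its end.\<close>

fun polygonal_path :: "'a::real_normed_vector list \<Rightarrow> real \<Rightarrow> 'a" where
  "polygonal_path [] = linepath 0 0"
| "polygonal_path [a] = linepath a a"
| "polygonal_path [a, b] = linepath a b"
| "polygonal_path (a # b # c # ps) = linepath a b +++ polygonal_path (b # c # ps)"

definition interior_of_simple_polygon :: "(real^2) set \<Rightarrow> bool" where
  "interior_of_simple_polygon \<Omega> \<longleftrightarrow>
     (\<exists>ps. simple_path (polygonal_path ps) \<and>
           pathfinish (polygonal_path ps) = pathstart (polygonal_path ps) \<and>
           \<Omega> = inside (path_image (polygonal_path ps)))"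

text \<open>The library constant \<open>triangulation\<close> admits simplices of all dimensions and asks that
  intersections be common faces; here all simplices are nondegenerate triangles.\<close>

definition triangulates :: "(real^2) set set \<Rightarrow> (real^2) set \<Rightarrow> bool" where
  "triangulates \<T> P \<longleftrightarrow>
     finite \<T> \<and> (\<forall>T\<in>\<T>. 2 simplex T) \<and> \<Union>\<T> = P \<and>
     (\<forall>T\<in>\<T>. \<forall>T'\<in>\<T>. T \<noteq> T' \<longrightarrow>
        T \<inter> T' = {} \<or>
        (\<exists>p. p extreme_point_of T \<and> p extreme_point_of T' \<and> T \<inter> T' = {p}) \<or>
        (T \<inter> T') edge_of T \<and> (T \<inter> T') edge_of T')"

definition vertices :: "(real^2) set set \<Rightarrow> (real^2) set" where
  "vertices \<T> = {p. \<exists>T\<in>\<T>. p extreme_point_of T}"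

text \<open>A side is recorded as the unordered pair of its end points (which are distinct, because
  \<open>edge_of\<close> requires dimension one).\<close>

definition sides :: "(real^2) set \<Rightarrow> (real^2) set set" where
  "sides T = {{p, q} |p q. closed_segment p q edge_of T}"

definition edges :: "(real^2) set set \<Rightarrow> (real^2) set set" where
  "edges \<T> = (\<Union>T\<in>\<T>. sides T)"

definition interior_edges :: "(real^2) set set \<Rightarrow> (real^2) set set" where
  "interior_edges \<T> = {e \<in> edges \<T>. card {T \<in> \<T>. e \<in> sides T} = 2}"

definition boundary_edges :: "(real^2) set set \<Rightarrow> (real^2) set set" where
  "boundary_edges \<T> = {e \<in> edges \<T>. card {T \<in> \<T>. e \<in> sides T} = 1}"

text \<open>The counterclockwise traversal of the boundary of the triangle \<open>T\<close> goes along one of its sides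
  from \<open>p\<close> to \<open>q\<close>: with \<open>r\<close> the third vertex, the triple \<open>(p, q, r)\<close> is positively oriented.\<close>

definition ccw_along :: "(real^2) set \<Rightarrow> real^2 \<Rightarrow> real^2 \<Rightarrow> bool" where
  "ccw_along T p q \<longleftrightarrow>
     (\<exists>r. T = convex hull {p, q, r} \<and> 0 < det (vector [q - p, r - p] :: real^2^2))"


section \<open>Piecewise constant matrix functions\<close>

text \<open>Elements of \<open>L\<^sup>\<infinity>\<close> are represented by functions on the plane; only their values almost
  everywhere on \<open>\<Omega>\<close> are meaningful.\<close>

definition L_infinity :: "(real^2) set \<Rightarrow> (real^2 \<Rightarrow> real^2^2) set" where
  "L_infinity \<Omega> = {\<sigma>. \<sigma> \<in> borel_measurable (lebesgue_on \<Omega>) \<and>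
                      (\<exists>C. AE y in lebesgue_on \<Omega>. norm (\<sigma> y) \<le> C)}"

definition PC :: "(real^2) set \<Rightarrow> (real^2) set set \<Rightarrow> (real^2 \<Rightarrow> real^2^2) set" where
  "PC \<Omega> \<T> = {\<sigma> \<in> L_infinity \<Omega>.
     \<forall>T\<in>\<T>. \<exists>M. transpose M = M \<and> (AE y in lebesgue_on (interior T). \<sigma> y = M)}"


section \<open>The finite element model\<close>

text \<open>The \<open>N\<close> vertices are labelled \<open>x 0, \<dots>, x (N - 1)\<close>, the boundary vertices being
  \<open>x 0, \<dots>, x (B - 1)\<close>. The hat functions are made unique as HOL functions by
  \<open>extensional\<close>.\<close>

definition hat :: "(real^2) set \<Rightarrow> (real^2) set set \<Rightarrow> nat \<Rightarrow> (nat \<Rightarrow> real^2) \<Rightarrow> nat \<Rightarrow> real^2 \<Rightarrow> real" where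
  "hat \<Omega> \<T> N x k = (THE v. v \<in> extensional (closure \<Omega>) \<and> continuous_on (closure \<Omega>) v \<and>
     (\<forall>T\<in>\<T>. \<exists>a b. \<forall>y\<in>T. v y = a \<bullet> y + b) \<and>
     (\<forall>j<N. v (x j) = (if j = k then 1 else 0)))"

text \<open>Unspecified where \<open>v\<close> is not differentiable; for hat functions that is a null set.\<close>

definition grad :: "(real^2 \<Rightarrow> real) \<Rightarrow> real^2 \<Rightarrow> real^2" where
  "grad v y = (THE D. GDERIV v y :> D)"

text \<open>The integral over the part \<open>S\<close> of the domain.\<close>

definition stiffness ::
    "(real^2) set \<Rightarrow> (real^2) set set \<Rightarrow> nat \<Rightarrow> (nat \<Rightarrow> real^2) \<Rightarrow> (real^2) set \<Rightarrow>
     (real^2 \<Rightarrow> real^2^2) \<Rightarrow> nat \<Rightarrow> nat \<Rightarrow> real" where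
  "stiffness \<Omega> \<T> N x S \<sigma> j k =
     (LINT y:S|lebesgue. (\<sigma> y *v grad (hat \<Omega> \<T> N x j) y) \<bullet> grad (hat \<Omega> \<T> N x k) y)"

definition fem_matrix ::
    "(real^2) set \<Rightarrow> (real^2) set set \<Rightarrow> nat \<Rightarrow> nat \<Rightarrow> (nat \<Rightarrow> real^2) \<Rightarrow>
     (real^2 \<Rightarrow> real^2^2) \<Rightarrow> real mat" where
  "fem_matrix \<Omega> \<T> N B x \<sigma> = Matrix.mat N N (\<lambda>(j, k).
     if j < B then (if j = k then 1 else 0) else stiffness \<Omega> \<T> N x \<Omega> \<sigma> j k)"

text \<open>The solution \<open>u\<close> of \<open>A u = (f, 0)\<close>; meaningful when \<open>A\<close> is invertible.\<close>

definition dirichlet_solution :: "nat \<Rightarrow> nat \<Rightarrow> real mat \<Rightarrow> real Matrix.vec \<Rightarrow> real Matrix.vec" where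
  "dirichlet_solution N B A f = (THE u. u \<in> carrier_vec N \<and> A *\<^sub>v u = f @\<^sub>v 0\<^sub>v (N - B))"

definition fem_DN ::
    "(real^2) set \<Rightarrow> (real^2) set set \<Rightarrow> nat \<Rightarrow> nat \<Rightarrow> (nat \<Rightarrow> real^2) \<Rightarrow>
     (real^2 \<Rightarrow> real^2^2) \<Rightarrow> real Matrix.vec \<Rightarrow> real Matrix.vec" where
  "fem_DN \<Omega> \<T> N B x \<sigma> f =
     (let u = dirichlet_solution N B (fem_matrix \<Omega> \<T> N B x \<sigma>) f
      in Matrix.vec B (\<lambda>j. \<Sum>k<N. stiffness \<Omega> \<T> N x \<Omega> \<sigma> j k * u $ k))"


section \<open>The resistor network\<close>

definition conductance ::
    "(real^2) set set \<Rightarrow> (nat \<Rightarrow> real^2) \<Rightarrow> ((real^2) set \<Rightarrow> real) \<Rightarrow> nat \<Rightarrow> nat \<Rightarrow> real" where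
  "conductance \<T> x \<gamma> j k = (if {x j, x k} \<in> edges \<T> then \<gamma> {x j, x k} else 0)"

definition network_matrix ::
    "(real^2) set set \<Rightarrow> nat \<Rightarrow> nat \<Rightarrow> (nat \<Rightarrow> real^2) \<Rightarrow> ((real^2) set \<Rightarrow> real) \<Rightarrow> real mat" where
  "network_matrix \<T> N B x \<gamma> = Matrix.mat N N (\<lambda>(j, k).
     if j < B then (if j = k then 1 else 0)
     else if j = k then (\<Sum>i\<in>{..<N} - {j}. conductance \<T> x \<gamma> j i)
     else - conductance \<T> x \<gamma> j k)"

definition network_DN ::
    "(real^2) set set \<Rightarrow> nat \<Rightarrow> nat \<Rightarrow> (nat \<Rightarrow> real^2) \<Rightarrow> ((real^2) set \<Rightarrow> real) \<Rightarrow>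
     real Matrix.vec \<Rightarrow> real Matrix.vec" where
  "network_DN \<T> N B x \<gamma> f =
     (let u = dirichlet_solution N B (network_matrix \<T> N B x \<gamma>) f
      in Matrix.vec B (\<lambda>j. \<Sum>k\<in>{..<N} - {j}. conductance \<T> x \<gamma> j k * (u $ j - u $ k)))"


section \<open>Splitting conditions\<close>

text \<open>The chosen orientation of an interior edge \<open>e\<close> is the directed edge \<open>d e = (p, q)\<close>
  with \<open>e = {p, q}\<close>.\<close>

definition splits_interior ::
    "(real^2) set \<Rightarrow> (real^2) set set \<Rightarrow> nat \<Rightarrow> (nat \<Rightarrow> real^2) \<Rightarrow> ((real^2) set \<Rightarrow> real) \<Rightarrow>
     ((real^2) set \<Rightarrow> (real^2) \<times> (real^2)) \<Rightarrow> ((real^2) set \<Rightarrow> real) \<Rightarrow> (real^2 \<Rightarrow> real^2^2) \<Rightarrow> bool" where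
  "splits_interior \<Omega> \<T> N x \<gamma> d \<alpha> \<sigma> \<longleftrightarrow>
     (\<forall>j<N. \<forall>k<N. \<forall>T\<in>\<T>. \<forall>T'\<in>\<T>. \<forall>p q.
        {x j, x k} \<in> interior_edges \<T> \<and> T \<noteq> T' \<and>
        {x j, x k} \<in> sides T \<and> {x j, x k} \<in> sides T' \<and>
        d {x j, x k} = (p, q) \<and> ccw_along T p q \<and> ccw_along T' q p \<longrightarrow>
        stiffness \<Omega> \<T> N x T \<sigma> j k = - (1/2) * conductance \<T> x \<gamma> j k - \<alpha> {x j, x k} \<and>
        stiffness \<Omega> \<T> N x T' \<sigma> j k = - (1/2) * conductance \<T> x \<gamma> j k + \<alpha> {x j, x k})"

definition splits_boundary ::
    "(real^2) set \<Rightarrow> (real^2) set set \<Rightarrow> nat \<Rightarrow> (nat \<Rightarrow> real^2) \<Rightarrow> ((real^2) set \<Rightarrow> real) \<Rightarrow>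
     (real^2 \<Rightarrow> real^2^2) \<Rightarrow> bool" where
  "splits_boundary \<Omega> \<T> N x \<gamma> \<sigma> \<longleftrightarrow>
     (\<forall>j<N. \<forall>k<N. \<forall>T\<in>\<T>.
        {x j, x k} \<in> boundary_edges \<T> \<and> {x j, x k} \<in> sides T \<longrightarrow>
        stiffness \<Omega> \<T> N x T \<sigma> j k = - conductance \<T> x \<gamma> j k)"

end

theory Submission
  imports Defs
begin

text \<open>The gradients of the three hat functions of a triangle sum to zero and span the plane, so a
  constant symmetric matrix on the triangle corresponds bijectively to its three off-diagonal
  stiffness integrals, one for each side, which can be prescribed arbitrarily. An edge lies in at
  most two triangles, and two triangles on it induce opposite orientations. Hence a network with
  given conductances is obtained by prescribing, over each edge, stiffness integrals with the
  right sum; one real parameter is free for each interior edge. The diagonal entries agree because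
  the rows of both full matrices sum to zero. Conversely, equality of \<open>L\<close> determines all entries of
  the stiffness matrix in which an interior vertex takes part, by symmetry, and equality of the
  Dirichlet-to-Neumann maps on unit vectors determines the remaining block.\<close>

no_notation scalar_prod (infix "\<bullet>" 70)

section \<open>Affine functions on a triangle\<close>

text \<open>The inverse of the correspondence between matrices and side integrals is written down
  explicitly: up to sign, the rank one matrices of the three side vectors are dual to the
  off-diagonal pairings of the gradients, and the area of the triangle is divided out. That an edge
  lies in at most two triangles has to be derived from the intersection rule: two triangles on the
  same side of an edge share a point off its line, whereas distinct triangles meet in at most a
  segment. The other obstacle is measure theoretic. Gradients of hat functions are controlled only
  inside the triangles and matrix functions are given only almost everywhere, so integrals over
  \<Omega> are compared after discarding the null frontiers of the triangles and of the
  polygon.\<close>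

definition verts :: "'a::euclidean_space set \<Rightarrow> 'a set" where
  "verts T = {p. p extreme_point_of T}"

text \<open>\<open>simplex\<close> only asserts that some affinely independent generating set
  exists. Its points are exactly the extreme points of the hull, so it can be named
  canonically.\<close>

lemma simplex_verts:
  assumes "n simplex T"
  shows "\<not> affine_dependent (verts T)" "int (card (verts T)) = n + 1" "convex hull (verts T) = T"
    "finite (verts T)"
proof -
  obtain C where C: "\<not> affine_dependent C" "int (card C) = n + 1" "T = convex hull C"
    using assms unfolding simplex_def by auto
  then have "verts T = C"
    by (simp add: verts_def extreme_point_of_convex_hull_affine_independent)
  then show "\<not> affine_dependent (verts T)" "int (card (verts T)) = n + 1" "convex hull (verts T) = T"
    "finite (verts T)"
    using C aff_independent_finite by auto
qed

lemma verts_subset: "verts T \<subseteq> T"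
  by (auto simp: verts_def extreme_point_of_def)

lemma interior_triangle_nonempty:
  fixes T :: "(real^2) set"
  assumes "2 simplex T"
  shows "interior T \<noteq> {}"
  using simplex_verts[OF assms] interior_convex_hull_eq_empty[of "verts T"] by auto

text \<open>Faces of a simplex are the hulls of subsets of its vertices, and by affine independence
  dimension one means exactly two vertices.\<close>

lemma edge_of_simplex:
  assumes T: "n simplex T"
  shows "F edge_of T \<longleftrightarrow> (\<exists>p\<in>verts T. \<exists>q\<in>verts T. p \<noteq> q \<and> F = closed_segment p q)"
proof -
  note V = simplex_verts[OF T]
  have "F edge_of T \<longleftrightarrow> (\<exists>C \<subseteq> verts T. F = convex hull C) \<and> aff_dim F = 1"
    using face_of_convex_hull_affine_independent[OF V(1)] V(3) by (simp add: edge_of_def)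
  also have "\<dots> \<longleftrightarrow> (\<exists>C \<subseteq> verts T. F = convex hull C \<and> card C = 2)"
  proof -
    have "aff_dim (convex hull C) = 1 \<longleftrightarrow> card C = 2" if "C \<subseteq> verts T" for C
      using affine_independent_iff_card[of C] affine_independent_subset[OF V(1) that]
      by (auto simp: aff_dim_convex_hull)
    then show ?thesis by auto
  qed
  also have "\<dots> \<longleftrightarrow> (\<exists>p\<in>verts T. \<exists>q\<in>verts T. p \<noteq> q \<and> F = closed_segment p q)"
  proof safe
    fix C assume "C \<subseteq> verts T" "card C = 2"
    then obtain p q where "C = {p, q}" "p \<noteq> q" "p \<in> verts T" "q \<in> verts T"
      by (auto simp: card_2_iff)
    then show "\<exists>p\<in>verts T. \<exists>q\<in>verts T. p \<noteq> q \<and> convex hull C = closed_segment p q"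
      by (metis segment_convex_hull)
  next
    fix p q assume "p \<in> verts T" "q \<in> verts T" "p \<noteq> q"
    then show "\<exists>C\<subseteq>verts T. closed_segment p q = convex hull C \<and> card C = 2"
      by (intro exI[of _ "{p, q}"]) (simp add: segment_convex_hull)
  qed
  finally show ?thesis .
qed

lemma sides_simplex:
  assumes "n simplex T"
  shows "sides T = {{p, q} |p q. p \<in> verts T \<and> q \<in> verts T \<and> p \<noteq> q}"
proof -
  have "closed_segment p q edge_of T \<longleftrightarrow> p \<in> verts T \<and> q \<in> verts T \<and> p \<noteq> q" for p q
    by (auto simp: edge_of_simplex[OF assms] doubleton_eq_iff)
  then show ?thesis by (simp add: sides_def)
qed

lemma doubleton_mem_sides:
  assumes "n simplex T"
  shows "{p, q} \<in> sides T \<longleftrightarrow> p \<in> verts T \<and> q \<in> verts T \<and> p \<noteq> q"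
  by (auto simp: sides_simplex[OF assms] doubleton_eq_iff)

text \<open>Moving one point of \<open>S\<close> to the origin makes the others linearly
  independent, so the prescribed increments extend to a linear functional;
  \<open>adjoint f 1\<close> is the vector representing it.\<close>

lemma affine_interpolation:
  fixes S :: "'a::euclidean_space set" and c :: "'a \<Rightarrow> real"
  assumes "\<not> affine_dependent S"
  shows "\<exists>g b. \<forall>p\<in>S. g \<bullet> p + b = c p"
proof (cases "S = {}")
  case False
  then obtain a where a: "a \<in> S" by auto
  have ind: "independent ((\<lambda>x. -a + x) ` (S - {a}))"
    using affine_dependent_iff_dependent2[OF a] assms by simp
  obtain f where f: "linear f" "\<forall>y\<in>(\<lambda>x. -a + x) ` (S - {a}). f y = c (a + y) - c a"
    using linear_independent_extend[OF ind, of "\<lambda>y. c (a + y) - c a"] by blast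
  define g where "g = adjoint f 1"
  have g: "g \<bullet> y = f y" for y
    using adjoint_works[OF f(1), of y 1] by (simp add: g_def inner_commute)
  have "g \<bullet> p + (c a - g \<bullet> a) = c p" if "p \<in> S" for p
  proof (cases "p = a")
    case False
    then have "f (-a + p) = c p - c a" using f(2) that by fastforce
    moreover have "f (-a + p) = g \<bullet> p - g \<bullet> a" by (simp flip: g add: inner_diff_right)
    ultimately show ?thesis by simp
  qed simp
  then show ?thesis by blast
qed auto

text \<open>The set where two affine functions agree is given by one linear equation, hence
  convex.\<close>

lemma affine_eq_on_hull:
  fixes S :: "'a::euclidean_space set"
  assumes "\<And>p. p \<in> S \<Longrightarrow> g \<bullet> p + b = g' \<bullet> p + b'" "y \<in> convex hull S"
  shows "g \<bullet> y + b = g' \<bullet> y + (b' :: real)"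
proof -
  have "convex {y. (g - g') \<bullet> y = b' - b}" by (rule convex_hyperplane)
  moreover have "S \<subseteq> {y. (g - g') \<bullet> y = b' - b}"
    using assms(1) by (auto simp: inner_diff_left algebra_simps)
  ultimately have "y \<in> {y. (g - g') \<bullet> y = b' - b}"
    using assms(2) hull_minimal[of S] by blast
  then show ?thesis by (auto simp: inner_diff_left algebra_simps)
qed

lemma affine_gradient_unique:
  fixes T :: "(real^2) set"
  assumes T: "2 simplex T" and eq: "\<And>p. p \<in> verts T \<Longrightarrow> g \<bullet> p + b = g' \<bullet> p + b'"
  shows "g = g'"
proof -
  have *: "(g - g') \<bullet> y = b' - b" if "y \<in> T" for y
    using affine_eq_on_hull[OF eq] that simplex_verts(3)[OF T]
    by (auto simp: inner_diff_left algebra_simps)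
  obtain y e where y: "e > 0" "ball y e \<subseteq> T"
    using interior_triangle_nonempty[OF T] by (auto simp: mem_interior)
  show ?thesis
  proof (rule ccontr)
    assume ne: "g \<noteq> g'"
    \<comment> \<open>Half a radius from the centre in the direction \<open>g - g'\<close>: this
      stays in the ball but raises the value of \<open>g - g'\<close> by a positive amount.\<close>
    define z where "z = y + (e / (2 * norm (g - g'))) *\<^sub>R (g - g')"
    have "z \<in> ball y e" using ne y(1) by (simp add: z_def dist_norm)
    then have "(g - g') \<bullet> z = (g - g') \<bullet> y" using * y by (metis centre_in_ball subsetD)
    then show False using ne y(1) by (simp add: z_def inner_right_distrib)
  qed
qed

text \<open>The gradient of the barycentric coordinate of \<open>p\<close>. Admitting every point
  \<open>p\<close> makes it 0 when \<open>p\<close> is no vertex of the triangle \<open>T\<close>,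
  so that sums over \<open>verts T\<close> extend to all labels.\<close>

definition nodal_grad :: "(real^2) set \<Rightarrow> real^2 \<Rightarrow> real^2" where
  "nodal_grad T p = (SOME g. \<exists>b. \<forall>q\<in>verts T. g \<bullet> q + b = of_bool (q = p))"

context
  fixes T :: "(real^2) set"
  assumes T: "2 simplex T"
begin

lemma nodal_grad: "\<exists>b. \<forall>q\<in>verts T. nodal_grad T p \<bullet> q + b = of_bool (q = p)"
  unfolding nodal_grad_def
  by (rule someI_ex) (rule affine_interpolation[OF simplex_verts(1)[OF T]])

lemma nodal_grad_unique:
  assumes "\<And>q. q \<in> verts T \<Longrightarrow> g \<bullet> q + b = of_bool (q = p)"
  shows "g = nodal_grad T p"
  using nodal_grad affine_gradient_unique[OF T, of g b] assms by metis

lemma nodal_grad_diff: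
  assumes "q \<in> verts T" "r \<in> verts T"
  shows "(q - r) \<bullet> nodal_grad T p = of_bool (q = p) - of_bool (r = p)"
proof -
  obtain b where "\<forall>q\<in>verts T. nodal_grad T p \<bullet> q + b = of_bool (q = p)" using nodal_grad by blast
  from bspec[OF this assms(1)] bspec[OF this assms(2)] show ?thesis
    by (simp add: inner_diff_right inner_commute[of "q - r"])
qed

lemma nodal_grad_eq_0: "p \<notin> verts T \<Longrightarrow> nodal_grad T p = 0"
  using nodal_grad_unique[of 0 0 p] by fastforce

text \<open>The linear function \<open>y \<bullet> w\<close> is the interpolant of its own vertex
  values, and gradients are compared. The \<open>+ 0\<close> in the proof is its constant
  term.\<close>

lemma nodal_grad_expansion: "(\<Sum>p\<in>verts T. (p \<bullet> w) *\<^sub>R nodal_grad T p) = w"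
proof -
  obtain b where b: "\<And>p q. q \<in> verts T \<Longrightarrow> nodal_grad T p \<bullet> q + b p = of_bool (q = p)"
    using nodal_grad by metis
  have "(\<Sum>p\<in>verts T. (p \<bullet> w) *\<^sub>R nodal_grad T p) \<bullet> q + (\<Sum>p\<in>verts T. (p \<bullet> w) * b p) = w \<bullet> q + 0"
    if q: "q \<in> verts T" for q
  proof -
    have "(\<Sum>p\<in>verts T. (p \<bullet> w) *\<^sub>R nodal_grad T p) \<bullet> q + (\<Sum>p\<in>verts T. (p \<bullet> w) * b p)
        = (\<Sum>p\<in>verts T. (p \<bullet> w) * (nodal_grad T p \<bullet> q + b p))"
      by (simp add: inner_sum_left sum.distrib algebra_simps)
    also have "\<dots> = (\<Sum>p\<in>verts T. if q = p then p \<bullet> w else 0)"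
      by (intro sum.cong) (auto simp: b[OF q])
    also have "\<dots> = q \<bullet> w"
      using q simplex_verts(4)[OF T] by simp
    finally show ?thesis by (simp add: inner_commute)
  qed
  then show ?thesis by (rule affine_gradient_unique[OF T])
qed

text \<open>The barycentric coordinates add up to the constant function 1, whose gradient is
  0.\<close>

lemma sum_nodal_grad: "(\<Sum>p\<in>verts T. nodal_grad T p) = 0"
proof -
  obtain b where b: "\<And>p q. q \<in> verts T \<Longrightarrow> nodal_grad T p \<bullet> q + b p = of_bool (q = p)"
    using nodal_grad by metis
  have "(\<Sum>p\<in>verts T. nodal_grad T p) \<bullet> q + (\<Sum>p\<in>verts T. b p) = 0 \<bullet> q + 1"
    if q: "q \<in> verts T" for q
  proof -
    have "(\<Sum>p\<in>verts T. nodal_grad T p) \<bullet> q + (\<Sum>p\<in>verts T. b p)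
        = (\<Sum>p\<in>verts T. nodal_grad T p \<bullet> q + b p)"
      by (simp add: inner_sum_left sum.distrib)
    also have "\<dots> = (\<Sum>p\<in>verts T. if q = p then 1 else 0)"
      by (intro sum.cong) (auto simp: b[OF q])
    finally show ?thesis using q simplex_verts(4)[OF T] by simp
  qed
  then show ?thesis by (rule affine_gradient_unique[OF T])
qed

section \<open>Symmetric matrices and the edges of a triangle\<close>

text \<open>Since \<open>(p - q) \<bullet> nodal_grad T r\<close> is 1 for \<open>r = p\<close>, -1 for \<open>r = q\<close> and 0 at the third vertex, the
  rank one matrix of \<open>p - q\<close> pairs two different nodal gradients to zero, except those of \<open>p\<close> and
  \<open>q\<close>, which it pairs to -1. The factor 1/2 is there because every edge is counted twice.\<close>

definition edge_matrix :: "((real^2) set \<Rightarrow> real) \<Rightarrow> real^2^2" where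
  "edge_matrix \<tau> = matrix (\<lambda>g. - (1/2) *\<^sub>R
     (\<Sum>p\<in>verts T. \<Sum>q\<in>verts T. (\<tau> {p, q} * ((p - q) \<bullet> g)) *\<^sub>R (p - q)))"

lemma edge_matrix_inner:
  "(edge_matrix \<tau> *v g) \<bullet> h
    = - (1/2) * (\<Sum>p\<in>verts T. \<Sum>q\<in>verts T. \<tau> {p, q} * (((p - q) \<bullet> g) * ((p - q) \<bullet> h)))"
proof -
  have "linear (\<lambda>g. - (1/2) *\<^sub>R
     (\<Sum>p\<in>verts T. \<Sum>q\<in>verts T. (\<tau> {p, q} * ((p - q) \<bullet> g)) *\<^sub>R (p - q)))"
    by (intro linear_compose_scale_right linear_compose_sum ballI linearI)
      (auto simp: inner_right_distrib algebra_simps)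
  then show ?thesis
    by (simp add: edge_matrix_def matrix_works inner_sum_left mult.assoc del: inner_diff_left)
qed

lemma transpose_edge_matrix: "transpose (edge_matrix \<tau>) = edge_matrix \<tau>"
proof -
  have "(transpose (edge_matrix \<tau>) *v g) \<bullet> h = (edge_matrix \<tau> *v g) \<bullet> h" for g h
  proof -
    have "(transpose (edge_matrix \<tau>) *v g) \<bullet> h = (edge_matrix \<tau> *v h) \<bullet> g"
      by (metis dot_lmul_matrix transpose_matrix_vector inner_commute)
    also have "\<dots> = (edge_matrix \<tau> *v g) \<bullet> h"
      unfolding edge_matrix_inner by (simp add: mult.commute)
    finally show ?thesis .
  qed
  then show ?thesis unfolding matrix_eq by (metis vector_eq_rdot)
qed

lemma edge_matrix:
  assumes p: "p \<in> verts T" and q: "q \<in> verts T" and "p \<noteq> q"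
  shows "(edge_matrix \<tau> *v nodal_grad T p) \<bullet> nodal_grad T q = \<tau> {p, q}"
proof -
  note fin = simplex_verts(4)[OF T]
  \<comment> \<open>Only the ordered pairs \<open>(p, q)\<close> and \<open>(q, p)\<close>
    contribute, each with one factor 1 and one factor -1. The nested conditionals give a form in
    which both sums collapse.\<close>
  have "(\<Sum>a\<in>verts T. \<Sum>b\<in>verts T.
          \<tau> {a, b} * (((a - b) \<bullet> nodal_grad T p) * ((a - b) \<bullet> nodal_grad T q)))
      = (\<Sum>a\<in>verts T. \<Sum>b\<in>verts T. (if b = q then if a = p then - \<tau> {a, b} else 0 else 0)
            + (if b = p then if a = q then - \<tau> {a, b} else 0 else 0))"
    using \<open>p \<noteq> q\<close> by (intro sum.cong refl) (auto simp: nodal_grad_diff)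
  also have "\<dots> = - 2 * \<tau> {p, q}"
    using p q fin by (simp add: sum.distrib insert_commute)
  finally show ?thesis by (simp add: edge_matrix_inner)
qed

text \<open>Pairing with the vanishing sum of all gradients turns each diagonal entry of the
  difference form into a sum of off-diagonal ones, which are 0. Since the gradients span, the
  difference then kills every vector.\<close>

lemma symmetric_matrix_eqI:
  fixes M M' :: "real^2^2"
  assumes sym: "transpose M = M" "transpose M' = M'"
    and eq: "\<And>p q. p \<in> verts T \<Longrightarrow> q \<in> verts T \<Longrightarrow> p \<noteq> q \<Longrightarrow>
      (M *v nodal_grad T p) \<bullet> nodal_grad T q = (M' *v nodal_grad T p) \<bullet> nodal_grad T q"
  shows "M = M'"
proof -
  let ?D = "M - M'"
  have off: "(?D *v nodal_grad T p) \<bullet> nodal_grad T q = 0"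
    if "p \<in> verts T" "q \<in> verts T" "p \<noteq> q" for p q
    using eq[OF that] by (simp add: matrix_vector_mult_diff_rdistrib inner_diff_left)
  have "?D *v nodal_grad T p = 0" if p: "p \<in> verts T" for p
  proof -
    have "0 = (?D *v nodal_grad T p) \<bullet> (\<Sum>q\<in>verts T. nodal_grad T q)" by (simp add: sum_nodal_grad)
    also have "\<dots> = (\<Sum>q\<in>verts T. (?D *v nodal_grad T p) \<bullet> nodal_grad T q)"
      by (simp add: inner_sum_right)
    also have "\<dots> = (\<Sum>q\<in>verts T. if q = p then (?D *v nodal_grad T p) \<bullet> nodal_grad T p else 0)"
      using off[OF p] by (intro sum.cong) auto
    finally have "(?D *v nodal_grad T p) \<bullet> nodal_grad T p = 0"
      using p simplex_verts(4)[OF T] by simp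
    then have "(?D *v nodal_grad T p) \<bullet> nodal_grad T q = 0" if "q \<in> verts T" for q
      using off[OF p that] by (cases "p = q") auto
    \<comment> \<open>These coefficients expand \<open>?D *v nodal_grad T p\<close> itself, so the
      left side is its squared norm.\<close>
    then have "(?D *v nodal_grad T p) \<bullet> (\<Sum>q\<in>verts T. (q \<bullet> (?D *v nodal_grad T p)) *\<^sub>R nodal_grad T q) = 0"
      by (simp add: inner_sum_right)
    then show ?thesis by (simp add: nodal_grad_expansion)
  qed
  then have "?D *v (\<Sum>p\<in>verts T. (p \<bullet> w) *\<^sub>R nodal_grad T p) = 0" for w
    by (simp add: linear_sum[OF matrix_vector_mul_linear] matrix_vector_mult_scaleR)
  then have "?D *v w = 0" for w by (simp add: nodal_grad_expansion)
  then have "M *v w = M' *v w" for w by (simp add: matrix_vector_mult_diff_rdistrib)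
  then show ?thesis by (simp add: matrix_eq)
qed

end

section \<open>Orientation\<close>

lemma det_rows_2: "det (vector [u, v] :: real^2^2) = vec_nth u 1 * vec_nth v 2 - vec_nth u 2 * vec_nth v 1"
  by (simp add: det_2)

text \<open>The gradients at \<open>q\<close> and at the third vertex \<open>r\<close> form the
  basis dual to \<open>q - p\<close>, \<open>r - p\<close>. Multiplicativity of the determinant
  therefore excludes \<open>D = 0\<close>, and exchanging \<open>p\<close> and \<open>q\<close>
  changes its sign.\<close>

lemma ccw_along_cases:
  assumes T: "2 simplex T" and pq: "p \<in> verts T" "q \<in> verts T" "p \<noteq> q"
  shows "ccw_along T p q \<or> ccw_along T q p"
proof -
  have "card (verts T - {p, q}) = 1"
    using simplex_verts[OF T] pq by (simp add: card_Diff_subset)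
  then obtain r where "verts T - {p, q} = {r}" by (auto simp: card_1_singleton_iff)
  then have r: "verts T = {p, q, r}" "r \<noteq> p" "r \<noteq> q" using pq by auto
  define g where "g = nodal_grad T q"
  define h where "h = nodal_grad T r"
  define D where "D = det (vector [q - p, r - p] :: real^2^2)"
  have "(q - p) \<bullet> g = 1" "(q - p) \<bullet> h = 0" "(r - p) \<bullet> g = 0" "(r - p) \<bullet> h = 1"
    using r pq(3) by (auto simp: g_def h_def nodal_grad_diff[OF T])
  then have "((q - p) \<bullet> g) * ((r - p) \<bullet> h) - ((q - p) \<bullet> h) * ((r - p) \<bullet> g) = 1" by simp
  moreover have "((q - p) \<bullet> g) * ((r - p) \<bullet> h) - ((q - p) \<bullet> h) * ((r - p) \<bullet> g)
      = D * det (vector [g, h] :: real^2^2)"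
    unfolding D_def det_rows_2 by (simp add: inner_vec_def sum_2 algebra_simps)
  ultimately have "D \<noteq> 0" by auto
  moreover have "det (vector [p - q, r - q] :: real^2^2) = - D"
    unfolding D_def det_rows_2 by (simp add: algebra_simps)
  moreover have "T = convex hull {p, q, r}" "T = convex hull {q, p, r}"
    using simplex_verts(3)[OF T] r(1) by (auto simp: insert_commute)
  ultimately show ?thesis
    unfolding ccw_along_def D_def by (metis neg_less_0_iff_less neg_0_less_iff_less not_less_iff_gr_or_eq)
qed

text \<open>A point slightly off the midpoint of the common side, moved towards \<open>r\<close>,
  still lies in the triangle with apex \<open>r'\<close>, because both apices are on the same
  side.\<close>

lemma same_side_triangles_overlap:
  fixes p q r r' :: "real^2"
  assumes "0 < det (vector [q - p, r - p] :: real^2^2)" "0 < det (vector [q - p, r' - p] :: real^2^2)"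
  shows "\<exists>z \<in> convex hull {p, q, r} \<inter> convex hull {p, q, r'}.
           0 < det (vector [q - p, z - p] :: real^2^2)"
proof -
  define cr where "cr u v = vec_nth u 1 * vec_nth v 2 - vec_nth u 2 * vec_nth v 1" for u v :: "real^2"
  have pos: "0 < cr (q - p) (r - p)" "0 < cr (q - p) (r' - p)"
    using assms by (simp_all add: det_rows_2 cr_def)
  \<comment> \<open>The coordinates of \<open>r - p\<close> in the basis \<open>q - p\<close>,
    \<open>r' - p\<close>, by Cramer's rule; \<open>t\<close> is positive as a quotient of the two
    positive determinants.\<close>
  define s where "s = cr (r - p) (r' - p) / cr (q - p) (r' - p)"
  define t where "t = cr (q - p) (r - p) / cr (q - p) (r' - p)"
  have "t > 0" using pos by (simp add: t_def)
  have "cr u w *\<^sub>R v = cr v w *\<^sub>R u + cr u v *\<^sub>R w" for u v w :: "real^2"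
    unfolding Finite_Cartesian_Product.vec_eq_iff forall_2 cr_def by (simp add: algebra_simps)
  from this[of "q - p" "r' - p" "r - p"]
  have "r - p = (1 / cr (q - p) (r' - p)) *\<^sub>R
      (cr (r - p) (r' - p) *\<^sub>R (q - p) + cr (q - p) (r - p) *\<^sub>R (r' - p))"
    using pos by (metis divide_inverse_commute inverse_eq_divide less_irrefl mult.right_neutral scaleR_one scaleR_scaleR left_inverse)
  then have r: "r - p = s *\<^sub>R (q - p) + t *\<^sub>R (r' - p)"
    by (simp add: s_def t_def scaleR_right_distrib)
  \<comment> \<open>Chosen so that \<open>e + e * \<bar>s\<bar> + e * \<bar>t\<bar>\<close> is 1/2:
    the perturbation of the midpoint then cannot push its coordinates in the second triangle out of
    range.\<close>
  define e where "e = 1 / (2 * (1 + \<bar>s\<bar> + \<bar>t\<bar>))"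
  have e: "0 < e" "e * (2 + 2 * \<bar>s\<bar> + 2 * \<bar>t\<bar>) = 1"
    by (auto simp: e_def field_simps add_pos_nonneg)
  have es: "2 * \<bar>e * s\<bar> + 2 * \<bar>e * t\<bar> + 2 * e = 1"
    using e by (simp add: abs_mult algebra_simps)
  have "0 \<le> e * t" using e(1) \<open>t > 0\<close> by simp
  moreover have "e \<le> 1 \<and> 0 \<le> (1 - e) / 2 + P \<and> (1 - e) / 2 + P + Q \<le> 1"
    if "2 * \<bar>P\<bar> + 2 * \<bar>Q\<bar> + 2 * e = 1" "0 \<le> Q" for P Q
    using that e(1) abs_ge_self[of P] abs_ge_minus_self[of P] abs_ge_self[of Q] by argo
  ultimately have bounds: "0 \<le> e" "e \<le> 1" "0 \<le> (1 - e) / 2 + e * s" "0 \<le> e * t"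
      "(1 - e) / 2 + e * s + e * t \<le> 1"
    using e(1) es by auto
  define z where "z = p + ((1 - e) / 2) *\<^sub>R (q - p) + e *\<^sub>R (r - p)"
  have "z \<in> convex hull {p, q, r}"
    unfolding convex_hull_3_alt z_def mem_Collect_eq
    by (rule exI[of _ "(1 - e) / 2"], rule exI[of _ e], intro conjI refl; use bounds in argo)
  moreover have "z = p + ((1 - e) / 2 + e * s) *\<^sub>R (q - p) + (e * t) *\<^sub>R (r' - p)"
    unfolding z_def r by (simp add: algebra_simps)
  then have "z \<in> convex hull {p, q, r'}"
    unfolding convex_hull_3_alt mem_Collect_eq
    by (intro exI[of _ "(1 - e) / 2 + e * s"] exI[of _ "e * t"] conjI; use bounds in argo)
  moreover have "cr u (c *\<^sub>R u + e *\<^sub>R v) = e * cr u v" for c u v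
    by (simp add: cr_def algebra_simps)
  then have "cr (q - p) (z - p) = e * cr (q - p) (r - p)"
    by (simp add: z_def add.assoc)
  then have "0 < det (vector [q - p, z - p] :: real^2^2)"
    using e(1) pos by (simp add: det_rows_2 cr_def)
  ultimately show ?thesis by blast
qed

section \<open>Triangulations\<close>

text \<open>A single common vertex is the degenerate segment with \<open>p = q\<close>, so one
  conclusion serves both cases. In the edge case a segment determines its end points, hence they are
  vertices of both triangles.\<close>

lemma triangles_Int:
  assumes "triangulates \<T> P" "T \<in> \<T>" "T' \<in> \<T>" "T \<noteq> T'" "T \<inter> T' \<noteq> {}"
  shows "\<exists>p \<in> verts T \<inter> verts T'. \<exists>q \<in> verts T \<inter> verts T'. T \<inter> T' = closed_segment p q"
proof -
  have s: "2 simplex T" "2 simplex T'"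
    using assms by (auto simp: triangulates_def)
  consider p where "p extreme_point_of T" "p extreme_point_of T'" "T \<inter> T' = {p}"
    | "(T \<inter> T') edge_of T" "(T \<inter> T') edge_of T'"
    using assms unfolding triangulates_def by meson
  then show ?thesis
  proof cases
    case 1
    then show ?thesis by (intro bexI[of _ p]) (auto simp: verts_def)
  next
    case 2
    then obtain p q p' q' where "p \<in> verts T" "q \<in> verts T" "T \<inter> T' = closed_segment p q"
      "p' \<in> verts T'" "q' \<in> verts T'" "T \<inter> T' = closed_segment p' q'"
      unfolding edge_of_simplex[OF s(1)] edge_of_simplex[OF s(2)] by blast
    moreover from this have "{p, q} = {p', q'}" by (metis closed_segment_eq)
    ultimately show ?thesis by (auto simp: doubleton_eq_iff)
  qed
qed

text \<open>A common interior point would give a segment nonempty interior in the plane.\<close>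

lemma triangles_interior_disjoint:
  assumes "triangulates \<T> P" "T \<in> \<T>" "T' \<in> \<T>" "y \<in> interior T" "y \<in> interior T'"
  shows "T = T'"
proof (rule ccontr)
  assume "T \<noteq> T'"
  moreover have y: "y \<in> interior (T \<inter> T')" using assms by simp
  then have "T \<inter> T' \<noteq> {}" using interior_subset by blast
  ultimately obtain p q where "T \<inter> T' = closed_segment p q"
    using triangles_Int[OF assms(1-3)] by blast
  with y show False by (simp add: interior_closed_segment_ge2)
qed

text \<open>Two such triangles lie on the same side of \<open>p q\<close> and so share a point off
  that line. Yet distinct triangles meet in a segment, on which this point would be collinear with
  \<open>p\<close> and \<open>q\<close>.\<close>

lemma ccw_along_unique:
  assumes tri: "triangulates \<T> P" "T \<in> \<T>" "T' \<in> \<T>" and ccw: "ccw_along T p q" "ccw_along T' p q"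
  shows "T = T'"
proof (rule ccontr)
  assume "T \<noteq> T'"
  obtain r r' where r: "T = convex hull {p, q, r}" "0 < det (vector [q - p, r - p] :: real^2^2)"
      "T' = convex hull {p, q, r'}" "0 < det (vector [q - p, r' - p] :: real^2^2)"
    using ccw by (auto simp: ccw_along_def)
  obtain z where z: "z \<in> T \<inter> T'" "0 < det (vector [q - p, z - p] :: real^2^2)"
    using same_side_triangles_overlap[OF r(2,4)] r(1,3) by auto
  obtain a b where ab: "T \<inter> T' = closed_segment a b"
    using triangles_Int[OF tri \<open>T \<noteq> T'\<close>] z(1) by blast
  have "p \<in> T \<inter> T'" "q \<in> T \<inter> T'" unfolding r(1,3) by (auto simp: hull_inc)
  then obtain t u v where pqz: "p = (1 - t) *\<^sub>R a + t *\<^sub>R b" "q = (1 - u) *\<^sub>R a + u *\<^sub>R b"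
      "z = (1 - v) *\<^sub>R a + v *\<^sub>R b"
    using z(1) unfolding ab closed_segment_def by blast
  have "det (vector [q - p, z - p] :: real^2^2) = 0"
    unfolding det_rows_2 pqz by (simp add: algebra_simps)
  with z(2) show False by simp
qed

text \<open>Each triangle on the edge induces one of its two orientations and each orientation
  belongs to at most one triangle. The pair is named so that \<open>T\<close> follows the given
  direction from \<open>p\<close> to \<open>q\<close>.\<close>

lemma edge_triangles_cases:
  assumes tri: "triangulates \<T> P" and e: "{p, q} \<in> edges \<T>"
  obtains (one) T where "{T \<in> \<T>. {p, q} \<in> sides T} = {T}"
    | (two) T T' where "T \<noteq> T'" "{T \<in> \<T>. {p, q} \<in> sides T} = {T, T'}"
        "ccw_along T p q" "ccw_along T' q p" "\<not> ccw_along T q p" "\<not> ccw_along T' p q"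
proof -
  let ?S = "{T \<in> \<T>. {p, q} \<in> sides T}"
  have simp: "2 simplex T" if "T \<in> \<T>" for T using tri that by (auto simp: triangulates_def)
  have cases: "ccw_along T p q \<or> ccw_along T q p" if "T \<in> ?S" for T
  proof -
    have "2 simplex T" "{p, q} \<in> sides T" using that simp by auto
    then show ?thesis using ccw_along_cases doubleton_mem_sides by blast
  qed
  note unique = ccw_along_unique[OF tri]
  obtain T where T: "T \<in> ?S" using e by (auto simp: edges_def)
  show thesis
  proof (cases "?S = {T}")
    case True
    then show ?thesis by (rule one)
  next
    case False
    then obtain T' where T': "T' \<in> ?S" "T' \<noteq> T" using T by blast
    have *: "?S = {A, A'} \<and> \<not> ccw_along A q p \<and> \<not> ccw_along A' p q"
      if "A \<in> ?S" "A' \<in> ?S" "A \<noteq> A'" "ccw_along A p q" "ccw_along A' q p" for A A'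
      using that cases unique by blast
    from cases[OF T] cases[OF T'(1)] show ?thesis
      using *[OF T T'(1)] *[OF T'(1) T] T T' two[of T T'] two[of T' T] unique by blast
  qed
qed

section \<open>Hat functions\<close>

lemma piecewise_affine_unique:
  assumes tri: "triangulates \<T> P"
    and v: "v \<in> extensional P" "\<And>T. T \<in> \<T> \<Longrightarrow> \<exists>a b. \<forall>y\<in>T. v y = a \<bullet> y + b"
    and w: "w \<in> extensional P" "\<And>T. T \<in> \<T> \<Longrightarrow> \<exists>a b. \<forall>y\<in>T. w y = a \<bullet> y + b"
    and eq: "\<And>p. p \<in> vertices \<T> \<Longrightarrow> v p = w p"
  shows "v = (w :: real^2 \<Rightarrow> real)"
proof (rule extensionalityI[OF v(1) w(1)])
  fix y assume "y \<in> P"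
  then obtain T where T: "T \<in> \<T>" "y \<in> T" "2 simplex T"
    using tri unfolding triangulates_def by blast
  obtain a b a' b' where ab: "\<forall>y\<in>T. v y = a \<bullet> y + b" "\<forall>y\<in>T. w y = a' \<bullet> y + b'"
    using v(2) w(2) T(1) by meson
  have "a \<bullet> p + b = a' \<bullet> p + b'" if "p \<in> verts T" for p
  proof -
    have "p \<in> vertices \<T>" using that T(1) by (auto simp: vertices_def verts_def)
    then show ?thesis using ab eq[of p] that verts_subset[of T] by auto
  qed
  then have "a \<bullet> y + b = a' \<bullet> y + b'"
    using affine_eq_on_hull simplex_verts(3)[OF T(3)] T(2) by metis
  then show "v y = w y" using ab T(2) by simp
qed

text \<open>Interpolants on two triangles agree at the ends of the common segment, hence along it;
  finitely many closed pieces then paste to a continuous function.\<close>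

lemma piecewise_affine_exists:
  assumes tri: "triangulates \<T> P"
  shows "\<exists>v. v \<in> extensional P \<and> continuous_on P v \<and>
     (\<forall>T\<in>\<T>. \<exists>a b. \<forall>y\<in>T. v y = a \<bullet> y + b) \<and> (\<forall>p\<in>vertices \<T>. v p = (c p :: real))"
proof -
  have simp: "2 simplex T" if "T \<in> \<T>" for T using tri that by (auto simp: triangulates_def)
  have fin: "finite \<T>" and P: "\<Union>\<T> = P" using tri by (auto simp: triangulates_def)
  have "\<forall>T\<in>\<T>. \<exists>g b. \<forall>p\<in>verts T. g \<bullet> p + b = c p"
    using affine_interpolation simplex_verts(1) simp by blast
  then obtain g b where gb: "\<And>T p. T \<in> \<T> \<Longrightarrow> p \<in> verts T \<Longrightarrow> g T \<bullet> p + b T = c p"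
    by metis
  have agree: "g T \<bullet> y + b T = g T' \<bullet> y + b T'" if TT': "T \<in> \<T>" "T' \<in> \<T>" "y \<in> T \<inter> T'" for T T' y
  proof (cases "T = T'")
    case False
    then obtain p q where pq: "p \<in> verts T \<inter> verts T'" "q \<in> verts T \<inter> verts T'"
        "T \<inter> T' = closed_segment p q"
      using triangles_Int[OF tri TT'(1,2) False] TT'(3) by blast
    show ?thesis
      by (rule affine_eq_on_hull[of "{p, q}"])
        (use gb[OF TT'(1)] gb[OF TT'(2)] pq TT'(3) in \<open>auto simp: segment_convex_hull\<close>)
  qed simp
  obtain v where v: "continuous_map (top_of_set P) euclideanreal v"
      "\<And>y T. T \<in> \<T> \<Longrightarrow> y \<in> topspace (top_of_set P) \<inter> T \<Longrightarrow> v y = g T \<bullet> y + b T"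
  proof (rule pasting_lemma_exists_closed[of \<T> "top_of_set P" "\<lambda>T. T" euclideanreal "\<lambda>T y. g T \<bullet> y + b T"])
    show "topspace (top_of_set P) \<subseteq> \<Union> ((\<lambda>T. T) ` \<T>)" using P by simp
    show "closedin (top_of_set P) T" if "T \<in> \<T>" for T
      using that P closed_simplex[OF simp[OF that]] by (intro closed_subset) auto
    show "continuous_map (subtopology (top_of_set P) T) euclideanreal (\<lambda>y. g T \<bullet> y + b T)" for T
      by (simp add: subtopology_subtopology continuous_on_add continuous_on_inner)
    show "g T \<bullet> y + b T = g T' \<bullet> y + b T'"
      if "T \<in> \<T>" "T' \<in> \<T>" "y \<in> topspace (top_of_set P) \<inter> T \<inter> T'" for T T' y
      by (rule agree) (use that in auto)
  qed (use fin in \<open>auto intro: that\<close>)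
  have vT: "v y = g T \<bullet> y + b T" if "T \<in> \<T>" "y \<in> T" for T y
    using v(2)[of T y] that P by auto
  have "restrict v P \<in> extensional P" by simp
  moreover have "continuous_on P (restrict v P)"
    using v(1) by (auto cong: continuous_on_cong)
  moreover have "\<exists>a b. \<forall>y\<in>T. restrict v P y = a \<bullet> y + b" if "T \<in> \<T>" for T
    using vT[OF that] that P by (intro exI[of _ "g T"] exI[of _ "b T"]) auto
  moreover have "restrict v P p = c p" if p: "p \<in> vertices \<T>" for p
  proof -
    obtain T where "T \<in> \<T>" "p \<in> verts T" using p by (auto simp: vertices_def verts_def)
    then show ?thesis using gb vT verts_subset[of T] P by (metis UnionI restrict_apply' subsetD)
  qed
  ultimately show ?thesis by (intro exI[of _ "restrict v P"]) simp
qed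

locale fem_triangulation =
  fixes \<Omega> :: "(real^2) set" and \<T> :: "(real^2) set set" and N :: nat and x :: "nat \<Rightarrow> real^2"
  assumes triangulation: "triangulates \<T> (closure \<Omega>)"
    and labels: "bij_betw x {..<N} (vertices \<T>)"
begin

lemma simplex: "T \<in> \<T> \<Longrightarrow> 2 simplex T"
  using triangulation by (simp add: triangulates_def)

lemma finite_triangles: "finite \<T>"
  using triangulation by (simp add: triangulates_def)

lemma Union_triangles: "\<Union>\<T> = closure \<Omega>"
  using triangulation by (simp add: triangulates_def)

lemma label_inj: "j < N \<Longrightarrow> k < N \<Longrightarrow> x j = x k \<longleftrightarrow> j = k"
  using bij_betw_imp_inj_on[OF labels] by (auto simp: inj_on_def)

lemma vertices_eq: "vertices \<T> = x ` {..<N}"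
  using labels by (simp add: bij_betw_def)

lemma verts_label: "T \<in> \<T> \<Longrightarrow> p \<in> verts T \<Longrightarrow> \<exists>j<N. p = x j"
  using vertices_eq by (auto simp: vertices_def verts_def)

lemma hat_spec:
  assumes k: "k < N"
  defines "v \<equiv> hat \<Omega> \<T> N x k"
  shows "v \<in> extensional (closure \<Omega>) \<and> continuous_on (closure \<Omega>) v \<and>
     (\<forall>T\<in>\<T>. \<exists>a b. \<forall>y\<in>T. v y = a \<bullet> y + b) \<and>
     (\<forall>j<N. v (x j) = (if j = k then 1 else 0))"
proof -
  let ?P = "\<lambda>v. v \<in> extensional (closure \<Omega>) \<and> continuous_on (closure \<Omega>) v \<and>
     (\<forall>T\<in>\<T>. \<exists>a b. \<forall>y\<in>T. v y = a \<bullet> y + b) \<and>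
     (\<forall>j<N. v (x j) = (if j = k then 1 else (0::real)))"
  have "\<exists>!v. ?P v"
  proof (rule ex_ex1I)
    show "\<exists>v. ?P v"
    proof -
      obtain v where "v \<in> extensional (closure \<Omega>)" "continuous_on (closure \<Omega>) v"
          "\<forall>T\<in>\<T>. \<exists>a b. \<forall>y\<in>T. v y = a \<bullet> y + b"
          and v: "\<forall>p\<in>vertices \<T>. v p = (if p = x k then 1 else 0)"
        using piecewise_affine_exists[OF triangulation, of "\<lambda>p. if p = x k then 1 else 0"] by blast
      moreover have "\<forall>j<N. v (x j) = (if j = k then 1 else 0)"
        using v k by (simp add: vertices_eq label_inj)
      ultimately show ?thesis by blast
    qed
  next
    fix v w assume "?P v" "?P w"
    then show "v = w"
      by (intro piecewise_affine_unique[OF triangulation]) (auto simp: vertices_eq)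
  qed
  from theI'[OF this] show ?thesis unfolding v_def hat_def by blast
qed

lemma hat_affine:
  assumes k: "k < N" and T: "T \<in> \<T>"
  shows "\<exists>b. \<forall>y\<in>T. hat \<Omega> \<T> N x k y = nodal_grad T (x k) \<bullet> y + b"
proof -
  obtain a b where ab: "\<forall>y\<in>T. hat \<Omega> \<T> N x k y = a \<bullet> y + b"
    using hat_spec[OF k] T by blast
  have "a \<bullet> q + b = of_bool (q = x k)" if q: "q \<in> verts T" for q
  proof -
    obtain j where "j < N" "q = x j" using verts_label[OF T q] by blast
    then have "hat \<Omega> \<T> N x k q = of_bool (q = x k)"
      using hat_spec[OF k] label_inj[of j k] k by simp
    then show ?thesis using ab q verts_subset[of T] by (metis subsetD)
  qed
  then have "a = nodal_grad T (x k)" by (rule nodal_grad_unique[OF simplex[OF T]])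
  then show ?thesis using ab by blast
qed

text \<open>Near an interior point of \<open>T\<close> the hat function is affine, which settles
  both differentiability and the description in \<open>grad\<close>.\<close>

lemma grad_hat:
  assumes k: "k < N" and T: "T \<in> \<T>" and y: "y \<in> interior T"
  shows "grad (hat \<Omega> \<T> N x k) y = nodal_grad T (x k)"
proof -
  obtain b where b: "\<forall>y\<in>T. hat \<Omega> \<T> N x k y = nodal_grad T (x k) \<bullet> y + b"
    using hat_affine[OF k T] by blast
  have "((\<lambda>y. nodal_grad T (x k) \<bullet> y + b) has_derivative (\<lambda>h. h \<bullet> nodal_grad T (x k))) (at y)"
    by (auto intro!: derivative_eq_intros simp: inner_commute)
  then have "GDERIV (hat \<Omega> \<T> N x k) y :> nodal_grad T (x k)"
    unfolding gderiv_def
    by (rule has_derivative_transform_within_open[OF _ open_interior y])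
      (use b interior_subset[of T] in \<open>metis subsetD\<close>)
  then show ?thesis unfolding grad_def
  proof (rule the_equality)
    fix D assume "GDERIV (hat \<Omega> \<T> N x k) y :> D"
    then have "(\<lambda>h. h \<bullet> D) = (\<lambda>h. h \<bullet> nodal_grad T (x k))"
      using \<open>GDERIV (hat \<Omega> \<T> N x k) y :> nodal_grad T (x k)\<close>
      unfolding gderiv_def by (rule has_derivative_unique)
    then show "D = nodal_grad T (x k)" by (metis vector_eq_ldot vector_eq_rdot)
  qed
qed

section \<open>Stiffness integrals\<close>

lemma measure_triangle_pos:
  assumes "T \<in> \<T>"
  shows "0 < measure lebesgue T"
proof -
  note s = simplex[OF assms]
  have "T \<in> lmeasurable" by (simp add: compact_simplex[OF s] lmeasurable_compact)
  moreover have "\<not> negligible T"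
    using interior_triangle_nonempty[OF s] convex_simplex[OF s] negligible_convex_interior by blast
  ultimately show ?thesis
    by (metis measure_nonneg negligible_iff_measure0 less_le)
qed

text \<open>Frontiers of convex sets are null. This discards the points where gradients are
  uncontrolled or several triangles meet.\<close>

lemma AE_triangle_interior: "AE y in lebesgue. \<forall>T\<in>\<T>. y \<in> T \<longrightarrow> y \<in> interior T"
proof -
  have "AE y in lebesgue. y \<notin> frontier T" if "T \<in> \<T>" for T
    using negligible_convex_frontier[OF convex_simplex[OF simplex[OF that]]]
    by (auto simp: negligible_iff_null_sets intro: AE_not_in)
  then have "AE y in lebesgue. \<forall>T\<in>\<T>. y \<notin> frontier T"
    by (simp add: AE_finite_all[OF finite_triangles])
  then show ?thesis
    by (rule AE_mp) (use closure_subset in \<open>auto simp: frontier_def\<close>)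
qed

lemma stiffness_integrand:
  assumes T: "T \<in> \<T>" and M: "AE y in lebesgue_on (interior T). \<sigma> y = M" and jk: "j < N" "k < N"
  shows "AE y in lebesgue. indicator T y *\<^sub>R ((\<sigma> y *v grad (hat \<Omega> \<T> N x j) y) \<bullet> grad (hat \<Omega> \<T> N x k) y)
     = indicator T y *\<^sub>R ((M *v nodal_grad T (x j)) \<bullet> nodal_grad T (x k))"
proof -
  have "AE y in lebesgue. y \<in> interior T \<longrightarrow> \<sigma> y = M"
    using M by (simp add: AE_restrict_space_iff)
  then show ?thesis using AE_triangle_interior
    by eventually_elim (use T in \<open>auto simp: grad_hat[OF _ T] jk indicator_def\<close>)
qed

lemma stiffness_triangle:
  assumes T: "T \<in> \<T>" and M: "AE y in lebesgue_on (interior T). \<sigma> y = M" and jk: "j < N" "k < N"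
  shows "set_integrable lebesgue T (\<lambda>y. (\<sigma> y *v grad (hat \<Omega> \<T> N x j) y) \<bullet> grad (hat \<Omega> \<T> N x k) y)"
    and "stiffness \<Omega> \<T> N x T \<sigma> j k
      = measure lebesgue T * ((M *v nodal_grad T (x j)) \<bullet> nodal_grad T (x k))"
proof -
  let ?c = "(M *v nodal_grad T (x j)) \<bullet> nodal_grad T (x k)"
  let ?F = "\<lambda>y. indicator T y *\<^sub>R ((\<sigma> y *v grad (hat \<Omega> \<T> N x j) y) \<bullet> grad (hat \<Omega> \<T> N x k) y)"
  have Tm: "T \<in> lmeasurable" by (simp add: compact_simplex[OF simplex[OF T]] lmeasurable_compact)
  have "integrable lebesgue (indicat_real T)"
    by (rule integrable_real_indicator) (use Tm in \<open>auto simp: fmeasurable_def\<close>)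
  then have int: "integrable lebesgue (\<lambda>y. indicator T y *\<^sub>R ?c)" by simp
  have ae: "AE y in lebesgue. indicator T y *\<^sub>R ?c = ?F y"
    using stiffness_integrand[OF assms] by (rule AE_mp) auto
  \<comment> \<open>The integrand is not known to be measurable beforehand; it inherits this from
    the multiple of an indicator that equals it almost everywhere, as Lebesgue measure is
    complete.\<close>
  have meas: "?F \<in> borel_measurable lebesgue"
    by (rule borel_measurable_AE[OF _ ae]) (use int in auto)
  show "set_integrable lebesgue T (\<lambda>y. (\<sigma> y *v grad (hat \<Omega> \<T> N x j) y) \<bullet> grad (hat \<Omega> \<T> N x k) y)"
    unfolding set_integrable_def using integrable_cong_AE[OF _ meas ae] int by auto
  have "stiffness \<Omega> \<T> N x T \<sigma> j k = (\<integral>y. indicator T y *\<^sub>R ?c \<partial>lebesgue)"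
    unfolding stiffness_def set_lebesgue_integral_def
    by (rule integral_cong_AE[symmetric]) (use meas int ae in auto)
  also have "\<dots> = measure lebesgue T * ?c"
    using Tm by simp
  finally show "stiffness \<Omega> \<T> N x T \<sigma> j k = measure lebesgue T * ?c" .
qed

end

section \<open>The polygonal domain and integrals over it\<close>

lemma negligible_polygonal_path:
  fixes ps :: "(real^2) list"
  shows "negligible (path_image (polygonal_path ps))"
proof -
  have seg: "negligible (closed_segment a b)" for a b :: "real^2"
    by (simp add: negligible_convex_interior interior_closed_segment_ge2)
  show ?thesis
  proof (induction ps rule: polygonal_path.induct)
    case (4 a b c ps)
    then have "negligible (path_image (linepath a b) \<union> path_image (polygonal_path (b # c # ps)))"
      using seg by simp
    then show ?case
      using negligible_subset path_image_join_subset by (metis polygonal_path.simps(4))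
  qed (simp_all only: polygonal_path.simps path_image_linepath seg)
qed

lemma simple_polygon_open_frontier:
  assumes "interior_of_simple_polygon \<Omega>"
  shows "open \<Omega>" "negligible (frontier \<Omega>)"
proof -
  obtain ps where ps: "simple_path (polygonal_path ps)" "\<Omega> = inside (path_image (polygonal_path ps))"
    using assms by (auto simp: interior_of_simple_polygon_def)
  have cl: "closed (path_image (polygonal_path ps))"
    using ps(1) by (simp add: closed_path_image simple_path_imp_path)
  show "open \<Omega>"
    unfolding ps(2) by (rule open_inside[OF cl])
  show "negligible (frontier \<Omega>)"
    unfolding ps(2) by (rule negligible_subset[OF negligible_polygonal_path frontier_inside_subset[OF cl]])
qed

locale polygon_triangulation = fem_triangulation +
  assumes polygon: "interior_of_simple_polygon \<Omega>"
begin

text \<open>Off the null frontier, openness makes membership in \<Omega> equivalent to membership in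
  its closure, the union of the triangles.\<close>

lemma AE_domain: "AE y in lebesgue. y \<in> \<Omega> \<longleftrightarrow> (\<exists>T\<in>\<T>. y \<in> T)"
proof -
  note \<Omega> = simple_polygon_open_frontier[OF polygon]
  have "AE y in lebesgue. y \<notin> frontier \<Omega>"
    using \<Omega>(2) by (auto simp: negligible_iff_null_sets intro: AE_not_in)
  then show ?thesis
  proof (rule AE_mp, intro AE_I2 impI)
    fix y assume "y \<notin> frontier \<Omega>"
    then have "y \<in> \<Omega> \<longleftrightarrow> y \<in> closure \<Omega>"
      using \<Omega>(1) closure_subset by (auto simp: frontier_def interior_open)
    then show "y \<in> \<Omega> \<longleftrightarrow> (\<exists>T\<in>\<T>. y \<in> T)" by (simp flip: Union_triangles)
  qed
qed

lemma PC_triangle: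
  assumes "\<sigma> \<in> PC \<Omega> \<T>" "T \<in> \<T>"
  obtains M where "transpose M = M" "AE y in lebesgue_on (interior T). \<sigma> y = M"
  using assms by (auto simp: PC_def)

lemma stiffness_sum:
  assumes \<sigma>: "\<sigma> \<in> PC \<Omega> \<T>" and jk: "j < N" "k < N"
  shows "stiffness \<Omega> \<T> N x \<Omega> \<sigma> j k = (\<Sum>T\<in>\<T>. stiffness \<Omega> \<T> N x T \<sigma> j k)"
proof -
  define F where "F y = (\<sigma> y *v grad (hat \<Omega> \<T> N x j) y) \<bullet> grad (hat \<Omega> \<T> N x k) y" for y
  have int: "integrable lebesgue (\<lambda>y. indicator T y *\<^sub>R F y)" if T: "T \<in> \<T>" for T
  proof -
    obtain M where M: "AE y in lebesgue_on (interior T). \<sigma> y = M"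
      by (rule PC_triangle[OF \<sigma> T])
    show ?thesis using stiffness_triangle(1)[OF T M jk] unfolding set_integrable_def F_def .
  qed
  have ae: "AE y in lebesgue. (\<Sum>T\<in>\<T>. indicator T y *\<^sub>R F y) = indicator \<Omega> y *\<^sub>R F y"
    using AE_domain AE_triangle_interior
  proof eventually_elim
    fix y assume y: "y \<in> \<Omega> \<longleftrightarrow> (\<exists>T\<in>\<T>. y \<in> T)" "\<forall>T\<in>\<T>. y \<in> T \<longrightarrow> y \<in> interior T"
    show "(\<Sum>T\<in>\<T>. indicator T y *\<^sub>R F y) = indicator \<Omega> y *\<^sub>R F y"
    proof (cases "y \<in> \<Omega>")
      case True
      then obtain T where T: "T \<in> \<T>" "y \<in> T" using y by blast
      \<comment> \<open>Almost every point is interior to each triangle containing it, so exactly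
        one summand survives.\<close>
      have "indicator T' y *\<^sub>R F y = (if T' = T then F y else 0)" if "T' \<in> \<T>" for T'
        using triangles_interior_disjoint[OF triangulation that T(1)] y(2) that T
        by (auto simp: indicator_def)
      then show ?thesis using True T(1) finite_triangles by simp
    next
      case False
      then show ?thesis using y(1) by (auto intro: sum.neutral)
    qed
  qed
  have "stiffness \<Omega> \<T> N x \<Omega> \<sigma> j k = (\<integral>y. (\<Sum>T\<in>\<T>. indicator T y *\<^sub>R F y) \<partial>lebesgue)"
    unfolding stiffness_def set_lebesgue_integral_def F_def[symmetric]
  proof (rule integral_cong_AE)
    show m: "(\<lambda>y. \<Sum>T\<in>\<T>. indicator T y *\<^sub>R F y) \<in> borel_measurable lebesgue"
      using int by (intro borel_measurable_sum) auto
    show "(\<lambda>y. indicator \<Omega> y *\<^sub>R F y) \<in> borel_measurable lebesgue"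
      by (rule borel_measurable_AE[OF m ae])
    show "AE y in lebesgue. indicator \<Omega> y *\<^sub>R F y = (\<Sum>T\<in>\<T>. indicator T y *\<^sub>R F y)"
      using ae by (rule AE_mp) auto
  qed
  also have "\<dots> = (\<Sum>T\<in>\<T>. \<integral>y. indicator T y *\<^sub>R F y \<partial>lebesgue)"
    using int by (rule Bochner_Integration.integral_sum)
  finally show ?thesis
    by (simp add: stiffness_def set_lebesgue_integral_def F_def)
qed

lemma stiffness_commute:
  assumes \<sigma>: "\<sigma> \<in> PC \<Omega> \<T>" and T: "T \<in> \<T>" and jk: "j < N" "k < N"
  shows "stiffness \<Omega> \<T> N x T \<sigma> j k = stiffness \<Omega> \<T> N x T \<sigma> k j"
proof -
  obtain M where M: "transpose M = M" "AE y in lebesgue_on (interior T). \<sigma> y = M"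
    by (rule PC_triangle[OF \<sigma> T])
  have "(M *v g) \<bullet> h = (M *v h) \<bullet> g" for g h
    using M(1) by (metis dot_lmul_matrix transpose_matrix_vector inner_commute)
  then show ?thesis using stiffness_triangle(2)[OF T M(2)] jk by simp
qed

text \<open>A hat function is constantly 0 on triangles without its vertex, and any two distinct
  vertices of a triangle span a side.\<close>

lemma stiffness_eq_0:
  assumes \<sigma>: "\<sigma> \<in> PC \<Omega> \<T>" and T: "T \<in> \<T>" and jk: "j < N" "k < N" "j \<noteq> k"
    and side: "{x j, x k} \<notin> sides T"
  shows "stiffness \<Omega> \<T> N x T \<sigma> j k = 0"
proof -
  obtain M where M: "AE y in lebesgue_on (interior T). \<sigma> y = M"
    by (rule PC_triangle[OF \<sigma> T])
  have "x j \<notin> verts T \<or> x k \<notin> verts T"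
    using side jk label_inj by (simp add: doubleton_mem_sides[OF simplex[OF T]])
  then have "nodal_grad T (x j) = 0 \<or> nodal_grad T (x k) = 0"
    using nodal_grad_eq_0[OF simplex[OF T]] by blast
  then show ?thesis using stiffness_triangle(2)[OF T M] jk by auto
qed

text \<open>The hat functions form a partition of unity; on one triangle, the gradients of absent
  vertices only pad the sum by zeros.\<close>

lemma sum_stiffness_row:
  assumes \<sigma>: "\<sigma> \<in> PC \<Omega> \<T>" and j: "j < N"
  shows "(\<Sum>k<N. stiffness \<Omega> \<T> N x \<Omega> \<sigma> j k) = 0"
proof -
  have "(\<Sum>k<N. stiffness \<Omega> \<T> N x T \<sigma> j k) = 0" if T: "T \<in> \<T>" for T
  proof -
    obtain M where M: "AE y in lebesgue_on (interior T). \<sigma> y = M"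
      by (rule PC_triangle[OF \<sigma> T])
    have "verts T \<subseteq> vertices \<T>" using T by (auto simp: vertices_def verts_def)
    then have "(\<Sum>p\<in>verts T. nodal_grad T p) = (\<Sum>p\<in>vertices \<T>. nodal_grad T p)"
      using nodal_grad_eq_0[OF simplex[OF T]]
      by (intro sum.mono_neutral_left) (auto simp: vertices_eq)
    then have "(\<Sum>k<N. nodal_grad T (x k)) = 0"
      using sum_nodal_grad[OF simplex[OF T]] sum.reindex_bij_betw[OF labels] by metis
    then have "(\<Sum>k<N. (M *v nodal_grad T (x j)) \<bullet> nodal_grad T (x k)) = 0"
      by (simp flip: inner_sum_right)
    then show ?thesis
      using j by (simp add: stiffness_triangle(2)[OF T M] flip: sum_distrib_left)
  qed
  then show ?thesis
    using j by (simp add: stiffness_sum[OF \<sigma>] sum.swap[of _ \<T>])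
qed

section \<open>Matrix functions determined by their side integrals\<close>

lemma PC_eqI:
  assumes \<sigma>: "\<sigma> \<in> PC \<Omega> \<T>" "\<sigma>' \<in> PC \<Omega> \<T>"
    and eq: "\<And>T j k. T \<in> \<T> \<Longrightarrow> j < N \<Longrightarrow> k < N \<Longrightarrow> {x j, x k} \<in> sides T \<Longrightarrow>
      stiffness \<Omega> \<T> N x T \<sigma> j k = stiffness \<Omega> \<T> N x T \<sigma>' j k"
  shows "AE y in lebesgue_on \<Omega>. \<sigma> y = \<sigma>' y"
proof -
  have "AE y in lebesgue. y \<in> interior T \<longrightarrow> \<sigma> y = \<sigma>' y" if T: "T \<in> \<T>" for T
  proof -
    obtain M M' where M: "transpose M = M" "AE y in lebesgue_on (interior T). \<sigma> y = M"
      "transpose M' = M'" "AE y in lebesgue_on (interior T). \<sigma>' y = M'"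
      using PC_triangle[OF \<sigma>(1) T] PC_triangle[OF \<sigma>(2) T] by metis
    have "M = M'"
    proof (rule symmetric_matrix_eqI[OF simplex[OF T] M(1,3)])
      fix p q assume pq: "p \<in> verts T" "q \<in> verts T" "p \<noteq> q"
      then obtain j k where jk: "j < N" "p = x j" "k < N" "q = x k"
        using verts_label[OF T] by meson
      then have "{x j, x k} \<in> sides T"
        using pq by (simp add: doubleton_mem_sides[OF simplex[OF T]])
      \<comment> \<open>The positive area cancels, leaving the pairings of the two constant
        matrices.\<close>
      then show "(M *v nodal_grad T p) \<bullet> nodal_grad T q = (M' *v nodal_grad T p) \<bullet> nodal_grad T q"
        using eq[OF T jk(1,3)] stiffness_triangle(2)[OF T M(2) jk(1,3)]
          stiffness_triangle(2)[OF T M(4) jk(1,3)] measure_triangle_pos[OF T] jk by simp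
    qed
    then show ?thesis
      using M(2,4) by (simp add: AE_restrict_space_iff) (auto elim: eventually_elim2)
  qed
  then have "AE y in lebesgue. \<forall>T\<in>\<T>. y \<in> interior T \<longrightarrow> \<sigma> y = \<sigma>' y"
    unfolding AE_finite_all[OF finite_triangles] by blast
  then have "AE y in lebesgue. y \<in> \<Omega> \<longrightarrow> \<sigma> y = \<sigma>' y"
    using AE_domain AE_triangle_interior by eventually_elim blast
  then show ?thesis
    using simple_polygon_open_frontier(1)[OF polygon]
    by (simp add: AE_restrict_space_iff borel_open)
qed

text \<open>Indexing the targets by unordered pairs makes them compatible with the symmetry in
  \<open>j\<close> and \<open>k\<close>. The constant matrices are placed on the disjoint open
  triangles, with value 0 elsewhere.\<close>

lemma PC_prescribed_stiffness:
  "\<exists>\<sigma>\<in>PC \<Omega> \<T>. \<forall>T\<in>\<T>. \<forall>j<N. \<forall>k<N. {x j, x k} \<in> sides T \<longrightarrow>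
     stiffness \<Omega> \<T> N x T \<sigma> j k = \<tau> T {x j, x k}"
proof -
  \<comment> \<open>Integration over \<open>T\<close> multiplies by its area, so the targets are
    divided by it in advance.\<close>
  define M where "M T = edge_matrix T (\<lambda>e. \<tau> T e / measure lebesgue T)" for T
  define \<sigma> where "\<sigma> y = (\<Sum>T\<in>\<T>. indicator (interior T) y *\<^sub>R M T)" for y
  have \<sigma>: "\<sigma> y = M T" if "T \<in> \<T>" "y \<in> interior T" for T y
  proof -
    have "indicator (interior T') y *\<^sub>R M T' = (if T' = T then M T else 0)" if "T' \<in> \<T>" for T'
      using triangles_interior_disjoint[OF triangulation that \<open>T \<in> \<T>\<close>] \<open>y \<in> interior T\<close>
      by (auto simp: indicator_def)
    then show ?thesis using that(1) finite_triangles by (simp add: \<sigma>_def)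
  qed
  then have ae: "AE y in lebesgue_on (interior T). \<sigma> y = M T" if "T \<in> \<T>" for T
    using that by (simp add: AE_restrict_space_iff)
  have "\<sigma> \<in> borel_measurable borel" unfolding \<sigma>_def by measurable
  then have "\<sigma> \<in> borel_measurable (lebesgue_on \<Omega>)"
    by (intro measurable_restrict_space1 measurable_completion) simp
  moreover have "norm (\<sigma> y) \<le> (\<Sum>T\<in>\<T>. norm (M T))" for y
    unfolding \<sigma>_def by (rule sum_norm_le) (auto simp: indicator_def)
  ultimately have "\<sigma> \<in> L_infinity \<Omega>" by (auto simp: L_infinity_def)
  then have "\<sigma> \<in> PC \<Omega> \<T>"
    using ae transpose_edge_matrix[OF simplex] unfolding PC_def M_def by blast
  moreover have "stiffness \<Omega> \<T> N x T \<sigma> j k = \<tau> T {x j, x k}"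
    if "T \<in> \<T>" "j < N" "k < N" "{x j, x k} \<in> sides T" for T j k
  proof -
    have "x j \<in> verts T" "x k \<in> verts T" "x j \<noteq> x k"
      using that(4) by (auto simp: doubleton_mem_sides[OF simplex[OF that(1)]])
    then show ?thesis
      using stiffness_triangle(2)[OF that(1) ae[OF that(1)] that(2,3)] measure_triangle_pos[OF that(1)]
      by (simp add: M_def edge_matrix[OF simplex[OF that(1)]])
  qed
  ultimately show ?thesis by blast
qed

end

section \<open>Comparison with the resistor network\<close>

text \<open>Invertibility makes the description in \<open>dirichlet_solution\<close> denote the
  solution; its equation in a unit row then reads off the boundary value.\<close>

lemma dirichlet_solution_boundary:
  assumes A: "A \<in> carrier_mat N N" "invertible_mat A" and "B \<le> N"
    and rows: "\<And>j. j < B \<Longrightarrow> row A j = unit_vec N j"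
    and f: "f \<in> carrier_vec B" and k: "k < B"
  shows "dirichlet_solution N B A f $ k = f $ k"
proof -
  obtain C where C: "A * C = 1\<^sub>m N" "C * A = 1\<^sub>m (dim_row C)"
    using A by (auto simp: invertible_mat_def inverts_mat_def)
  \<comment> \<open>\<open>invertible_mat\<close> leaves the dimensions of the inverse open; they
    are recovered from the two products.\<close>
  have Cc: "C \<in> carrier_mat N N"
  proof (rule carrier_matI)
    show "dim_col C = N" using arg_cong[OF C(1), of dim_col] by simp
    show "dim_row C = N" using arg_cong[OF C(2), of dim_col] A(1) by simp
  qed
  let ?b = "f @\<^sub>v 0\<^sub>v (N - B)"
  have b: "?b \<in> carrier_vec N" using append_carrier_vec[OF f zero_carrier_vec[of "N - B"]] \<open>B \<le> N\<close> by simp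
  have sol: "u = C *\<^sub>v ?b" if "u \<in> carrier_vec N" "A *\<^sub>v u = ?b" for u
    using that C(2) Cc A(1) by (metis assoc_mult_mat_vec carrier_matD(1) one_mult_mat_vec)
  have w: "C *\<^sub>v ?b \<in> carrier_vec N" using Cc b by simp
  have AC: "A *\<^sub>v (C *\<^sub>v ?b) = ?b"
    using C(1) Cc A(1) b by (metis assoc_mult_mat_vec one_mult_mat_vec)
  have u: "dirichlet_solution N B A f = C *\<^sub>v ?b"
    unfolding dirichlet_solution_def
  proof (rule the_equality)
    show "C *\<^sub>v ?b \<in> carrier_vec N \<and> A *\<^sub>v (C *\<^sub>v ?b) = ?b" using w AC ..
  qed (rule sol, blast+)
  have "(A *\<^sub>v (C *\<^sub>v ?b)) $ k = scalar_prod (unit_vec N k) (C *\<^sub>v ?b)"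
    using k \<open>B \<le> N\<close> A(1) rows[OF k] index_mult_mat_vec[of k A "C *\<^sub>v ?b"] by auto
  also have "\<dots> = (C *\<^sub>v ?b) $ k"
    using k \<open>B \<le> N\<close> by (intro scalar_prod_left_unit[OF w]) simp
  finally have "(A *\<^sub>v (C *\<^sub>v ?b)) $ k = (C *\<^sub>v ?b) $ k" .
  then show ?thesis using AC u k f by simp
qed

text \<open>The full Kirchhoff matrix. \<open>network_matrix\<close> replaces its boundary rows by
  unit rows, while \<open>network_DN\<close> evaluates exactly those boundary rows.\<close>

definition network_laplacian ::
    "(real^2) set set \<Rightarrow> nat \<Rightarrow> (nat \<Rightarrow> real^2) \<Rightarrow> ((real^2) set \<Rightarrow> real) \<Rightarrow> nat \<Rightarrow> nat \<Rightarrow> real" where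
  "network_laplacian \<T> N x \<gamma> j k =
     (if j = k then \<Sum>i\<in>{..<N} - {j}. conductance \<T> x \<gamma> j i else - conductance \<T> x \<gamma> j k)"

lemma network_laplacian_commute: "network_laplacian \<T> N x \<gamma> j k = network_laplacian \<T> N x \<gamma> k j"
  by (auto simp: network_laplacian_def conductance_def insert_commute)

lemma network_laplacian_mult:
  assumes "j < N"
  shows "(\<Sum>k\<in>{..<N} - {j}. conductance \<T> x \<gamma> j k * (u j - u k))
    = (\<Sum>k<N. network_laplacian \<T> N x \<gamma> j k * u k)"
proof -
  have "(\<Sum>k<N. network_laplacian \<T> N x \<gamma> j k * u k)
      = network_laplacian \<T> N x \<gamma> j j * u j + (\<Sum>k\<in>{..<N} - {j}. network_laplacian \<T> N x \<gamma> j k * u k)"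
    using assms by (simp add: sum.remove)
  also have "(\<Sum>k\<in>{..<N} - {j}. network_laplacian \<T> N x \<gamma> j k * u k)
      = - (\<Sum>k\<in>{..<N} - {j}. conductance \<T> x \<gamma> j k * u k)"
    by (simp add: network_laplacian_def flip: sum_negf)
  finally show ?thesis
    by (simp add: network_laplacian_def right_diff_distrib sum_subtractf sum_distrib_right)
qed

text \<open>The right-hand sides of both splitting conditions as one function of a triangle and an
  unordered edge, the form in which side integrals can be prescribed.\<close>

definition split_value ::
    "(real^2) set set \<Rightarrow> ((real^2) set \<Rightarrow> real) \<Rightarrow> ((real^2) set \<Rightarrow> (real^2) \<times> (real^2)) \<Rightarrow>
     ((real^2) set \<Rightarrow> real) \<Rightarrow> (real^2) set \<Rightarrow> (real^2) set \<Rightarrow> real" where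
  "split_value \<T> \<gamma> d \<alpha> T e =
     (if e \<in> interior_edges \<T>
      then - (1/2) * \<gamma> e + (if ccw_along T (fst (d e)) (snd (d e)) then - \<alpha> e else \<alpha> e)
      else - \<gamma> e)"

section \<open>Splitting over the edges and reconstruction\<close>

context polygon_triangulation
begin

lemma interior_edge_triangles:
  assumes d: "{p, q} = e" and e: "e \<in> interior_edges \<T>"
  obtains T T' where "T \<noteq> T'" "{T \<in> \<T>. e \<in> sides T} = {T, T'}" "ccw_along T p q" "\<not> ccw_along T' p q"
proof -
  have "{p, q} \<in> edges \<T>" using d e by (simp add: interior_edges_def)
  from edge_triangles_cases[OF triangulation this] show ?thesis
  proof cases
    case (1 T)
    then show ?thesis using d e by (simp add: interior_edges_def)
  next
    case (2 T T')
    then show ?thesis using that d by auto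
  qed
qed

lemma boundary_edge_triangle:
  assumes e: "e \<in> edges \<T>" "e \<notin> interior_edges \<T>"
  obtains T where "{T \<in> \<T>. e \<in> sides T} = {T}"
proof -
  obtain p q where pq: "e = {p, q}" using e(1) by (auto simp: edges_def sides_def)
  then have "{p, q} \<in> edges \<T>" using e(1) by simp
  from edge_triangles_cases[OF triangulation this] show ?thesis
  proof cases
    case (1 T)
    then show ?thesis using that pq by simp
  next
    case (2 T T')
    then show ?thesis using e pq by (simp add: interior_edges_def)
  qed
qed

lemma stiffness_edge_sum:
  assumes \<sigma>: "\<sigma> \<in> PC \<Omega> \<T>" and jk: "j < N" "k < N" "j \<noteq> k"
  shows "stiffness \<Omega> \<T> N x \<Omega> \<sigma> j k
    = (\<Sum>T\<in>{T \<in> \<T>. {x j, x k} \<in> sides T}. stiffness \<Omega> \<T> N x T \<sigma> j k)"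
  unfolding stiffness_sum[OF \<sigma> jk(1,2)]
  by (rule sum.mono_neutral_right) (use finite_triangles stiffness_eq_0[OF \<sigma> _ jk] in auto)

lemma stiffness_eq_laplacian:
  assumes \<sigma>: "\<sigma> \<in> PC \<Omega> \<T>"
    and off: "\<And>j k. j < N \<Longrightarrow> k < N \<Longrightarrow> j \<noteq> k \<Longrightarrow>
      stiffness \<Omega> \<T> N x \<Omega> \<sigma> j k = - conductance \<T> x \<gamma> j k"
    and jk: "j < N" "k < N"
  shows "stiffness \<Omega> \<T> N x \<Omega> \<sigma> j k = network_laplacian \<T> N x \<gamma> j k"
proof (cases "j = k")
  case True
  have "0 = stiffness \<Omega> \<T> N x \<Omega> \<sigma> j j + (\<Sum>i\<in>{..<N} - {j}. stiffness \<Omega> \<T> N x \<Omega> \<sigma> j i)"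
    using sum_stiffness_row[OF \<sigma> jk(1)] jk(1) by (simp add: sum.remove)
  also have "\<dots> = stiffness \<Omega> \<T> N x \<Omega> \<sigma> j j - (\<Sum>i\<in>{..<N} - {j}. conductance \<T> x \<gamma> j i)"
    using jk(1) by (simp add: off flip: sum_negf)
  finally show ?thesis using True by (simp add: network_laplacian_def)
qed (use off jk in \<open>simp add: network_laplacian_def\<close>)

text \<open>Equal full matrices give equal \<open>L\<close>, hence the same Dirichlet solution, to
  which the boundary rows are applied.\<close>

lemma same_operators:
  assumes B: "B \<le> N"
    and eq: "\<And>j k. j < N \<Longrightarrow> k < N \<Longrightarrow>
      stiffness \<Omega> \<T> N x \<Omega> \<sigma> j k = network_laplacian \<T> N x \<gamma> j k"
  shows "fem_matrix \<Omega> \<T> N B x \<sigma> = network_matrix \<T> N B x \<gamma>"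
    and "fem_DN \<Omega> \<T> N B x \<sigma> f = network_DN \<T> N B x \<gamma> f"
proof -
  show mat: "fem_matrix \<Omega> \<T> N B x \<sigma> = network_matrix \<T> N B x \<gamma>"
    by (rule eq_matI) (auto simp: fem_matrix_def network_matrix_def eq network_laplacian_def)
  show "fem_DN \<Omega> \<T> N B x \<sigma> f = network_DN \<T> N B x \<gamma> f"
    using B unfolding fem_DN_def network_DN_def mat Let_def
    by (intro eq_vecI) (auto simp: network_laplacian_mult eq)
qed

lemma split_stiffness:
  assumes \<sigma>: "\<sigma> \<in> PC \<Omega> \<T>"
    and d: "\<And>e. e \<in> interior_edges \<T> \<Longrightarrow> {fst (d e), snd (d e)} = e"
    and split: "\<And>T j k. T \<in> \<T> \<Longrightarrow> j < N \<Longrightarrow> k < N \<Longrightarrow> {x j, x k} \<in> sides T \<Longrightarrow>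
      stiffness \<Omega> \<T> N x T \<sigma> j k = split_value \<T> \<gamma> d \<alpha> T {x j, x k}"
  shows "splits_interior \<Omega> \<T> N x \<gamma> d \<alpha> \<sigma>" "splits_boundary \<Omega> \<T> N x \<gamma> \<sigma>"
    and "\<And>j k. j < N \<Longrightarrow> k < N \<Longrightarrow> stiffness \<Omega> \<T> N x \<Omega> \<sigma> j k = network_laplacian \<T> N x \<gamma> j k"
proof -
  have cond: "conductance \<T> x \<gamma> j k = \<gamma> {x j, x k}" if "T \<in> \<T>" "{x j, x k} \<in> sides T" for T j k
    using that by (auto simp: conductance_def edges_def)
  show "splits_interior \<Omega> \<T> N x \<gamma> d \<alpha> \<sigma>"
    unfolding splits_interior_def
  proof (intro allI ballI impI, elim conjE)
    fix j k T T' p q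
    assume jk: "j < N" "k < N" and T: "T \<in> \<T>" "T' \<in> \<T>" "T \<noteq> T'"
      and e: "{x j, x k} \<in> interior_edges \<T>" and s: "{x j, x k} \<in> sides T" "{x j, x k} \<in> sides T'"
      and pq: "d {x j, x k} = (p, q)" and ccw: "ccw_along T p q" "ccw_along T' q p"
    \<comment> \<open>\<open>split_value\<close> tests only the direction from \<open>p\<close> to
      \<open>q\<close>; failing this test puts \<open>T'\<close> in the branch with
      \<open>\<alpha>\<close>.\<close>
    have "\<not> ccw_along T' p q" using ccw_along_unique[OF triangulation T(1,2) ccw(1)] T(3) by blast
    then show "stiffness \<Omega> \<T> N x T \<sigma> j k = - (1/2) * conductance \<T> x \<gamma> j k - \<alpha> {x j, x k} \<and>
        stiffness \<Omega> \<T> N x T' \<sigma> j k = - (1/2) * conductance \<T> x \<gamma> j k + \<alpha> {x j, x k}"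
      using ccw(1) e pq split[OF T(1) jk s(1)] split[OF T(2) jk s(2)] cond[OF T(1) s(1)]
      by (simp add: split_value_def)
  qed
  have "e \<notin> interior_edges \<T>" if "e \<in> boundary_edges \<T>" for e
    using that by (auto simp: interior_edges_def boundary_edges_def)
  then show "splits_boundary \<Omega> \<T> N x \<gamma> \<sigma>"
    unfolding splits_boundary_def using split cond by (simp add: split_value_def)
  have "stiffness \<Omega> \<T> N x \<Omega> \<sigma> j k = - conductance \<T> x \<gamma> j k"
    if jk: "j < N" "k < N" "j \<noteq> k" for j k
  proof -
    let ?e = "{x j, x k}"
    let ?S = "{T \<in> \<T>. ?e \<in> sides T}"
    have sum: "stiffness \<Omega> \<T> N x \<Omega> \<sigma> j k = (\<Sum>T\<in>?S. split_value \<T> \<gamma> d \<alpha> T ?e)"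
      using split jk by (simp add: stiffness_edge_sum[OF \<sigma>])
    consider "?e \<notin> edges \<T>" | "?e \<in> interior_edges \<T>" | "?e \<in> edges \<T>" "?e \<notin> interior_edges \<T>"
      by blast
    then show ?thesis
    proof cases
      case 1
      then have "?S = {}" by (auto simp: edges_def)
      with 1 show ?thesis unfolding sum by (simp only: sum.empty conductance_def if_False minus_zero)
    next
      case 2
      \<comment> \<open>Exactly one of the two triangles follows \<open>d ?e\<close>, so
        \<open>- \<alpha>\<close> and \<open>\<alpha>\<close> cancel and the two halves add up to
        the full conductance.\<close>
      obtain T T' where T: "T \<noteq> T'" "?S = {T, T'}" "ccw_along T (fst (d ?e)) (snd (d ?e))"
          "\<not> ccw_along T' (fst (d ?e)) (snd (d ?e))"
        by (rule interior_edge_triangles[OF d[OF 2] 2])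
      then show ?thesis unfolding sum T(2) using 2
        by (simp add: split_value_def conductance_def interior_edges_def)
    next
      case 3
      obtain T where T: "?S = {T}" by (rule boundary_edge_triangle[OF 3])
      then show ?thesis unfolding sum T using 3
        by (simp add: split_value_def conductance_def)
    qed
  qed
  then show "\<And>j k. j < N \<Longrightarrow> k < N \<Longrightarrow> stiffness \<Omega> \<T> N x \<Omega> \<sigma> j k = network_laplacian \<T> N x \<gamma> j k"
    by (rule stiffness_eq_laplacian[OF \<sigma>])
qed

text \<open>On an interior edge, \<open>\<alpha>\<close> is read off the triangle following
  \<open>d e\<close>, and the known sum forces the integral over the other one. On any other edge
  the sum has a single term.\<close>

lemma stiffness_split_exists:
  assumes \<sigma>: "\<sigma> \<in> PC \<Omega> \<T>"
    and d: "\<And>e. e \<in> interior_edges \<T> \<Longrightarrow> {fst (d e), snd (d e)} = e"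
    and off: "\<And>j k. j < N \<Longrightarrow> k < N \<Longrightarrow> j \<noteq> k \<Longrightarrow>
      stiffness \<Omega> \<T> N x \<Omega> \<sigma> j k = - conductance \<T> x \<gamma> j k"
  shows "\<exists>\<alpha>. \<forall>T\<in>\<T>. \<forall>j<N. \<forall>k<N. {x j, x k} \<in> sides T \<longrightarrow>
      stiffness \<Omega> \<T> N x T \<sigma> j k = split_value \<T> \<gamma> d \<alpha> T {x j, x k}"
proof -
  have ne: "j \<noteq> k" if "T \<in> \<T>" "{x j, x k} \<in> sides T" for T j k
    using that doubleton_mem_sides[OF simplex] by blast
  have total: "(\<Sum>T\<in>{T \<in> \<T>. {x j, x k} \<in> sides T}. stiffness \<Omega> \<T> N x T \<sigma> j k) = - \<gamma> {x j, x k}"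
    if "T \<in> \<T>" "{x j, x k} \<in> sides T" "j < N" "k < N" for T j k
    using off[OF that(3,4) ne[OF that(1,2)]] stiffness_edge_sum[OF \<sigma> that(3,4) ne[OF that(1,2)]] that
    by (auto simp: conductance_def edges_def)
  have "\<exists>a. \<forall>T\<in>\<T>. \<forall>j<N. \<forall>k<N. {x j, x k} = e \<and> e \<in> sides T \<longrightarrow>
      stiffness \<Omega> \<T> N x T \<sigma> j k = - (1/2) * \<gamma> e + (if ccw_along T (fst (d e)) (snd (d e)) then - a else a)"
    if e: "e \<in> interior_edges \<T>" for e
  proof -
    obtain T T' where T: "T \<noteq> T'" "{T \<in> \<T>. e \<in> sides T} = {T, T'}" "ccw_along T (fst (d e)) (snd (d e))"
          "\<not> ccw_along T' (fst (d e)) (snd (d e))"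
      by (rule interior_edge_triangles[OF d[OF e] e])
    then have TT: "T \<in> \<T>" "T' \<in> \<T>" "e \<in> sides T" "e \<in> sides T'" by auto
    obtain p q where pq: "p \<in> verts T" "q \<in> verts T" "e = {p, q}"
      using TT(3) by (auto simp: sides_simplex[OF simplex[OF TT(1)]])
    obtain j k where jk: "j < N" "p = x j" "k < N" "q = x k"
      using verts_label[OF TT(1)] pq by meson
    define a where "a = - (1/2) * \<gamma> e - stiffness \<Omega> \<T> N x T \<sigma> j k"
    have s: "stiffness \<Omega> \<T> N x T \<sigma> j k = - (1/2) * \<gamma> e - a" "stiffness \<Omega> \<T> N x T' \<sigma> j k = - (1/2) * \<gamma> e + a"
      using total[of T j k] T(1,2) TT jk pq(3) by (auto simp: a_def)
    show ?thesis
    proof (intro exI[of _ a] ballI allI impI, elim conjE)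
      fix S j' k' assume S: "S \<in> \<T>" "j' < N" "k' < N" "{x j', x k'} = e" "e \<in> sides S"
      \<comment> \<open>An edge has two labellings; symmetry of the integrals lets the same
        \<open>a\<close> serve both.\<close>
      have "(j', k') = (j, k) \<or> (j', k') = (k, j)"
        using S jk pq(3) label_inj by (auto simp: doubleton_eq_iff)
      then have "stiffness \<Omega> \<T> N x S \<sigma> j' k' = stiffness \<Omega> \<T> N x S \<sigma> j k"
        using stiffness_commute[OF \<sigma> S(1)] jk by auto
      moreover have "S = T \<or> S = T'" using S T(2) by blast
      ultimately show "stiffness \<Omega> \<T> N x S \<sigma> j' k'
          = - (1/2) * \<gamma> e + (if ccw_along S (fst (d e)) (snd (d e)) then - a else a)"
        using s T(3,4) by auto
    qed
  qed
  then obtain \<alpha> where \<alpha>: "\<And>e T j k. e \<in> interior_edges \<T> \<Longrightarrow> T \<in> \<T> \<Longrightarrow> j < N \<Longrightarrow> k < N \<Longrightarrow> {x j, x k} = e \<Longrightarrow>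
      e \<in> sides T \<Longrightarrow>
      stiffness \<Omega> \<T> N x T \<sigma> j k = - (1/2) * \<gamma> e + (if ccw_along T (fst (d e)) (snd (d e)) then - \<alpha> e else \<alpha> e)"
    by metis
  have "stiffness \<Omega> \<T> N x T \<sigma> j k = split_value \<T> \<gamma> d \<alpha> T {x j, x k}"
    if T: "T \<in> \<T>" "j < N" "k < N" "{x j, x k} \<in> sides T" for T j k
  proof (cases "{x j, x k} \<in> interior_edges \<T>")
    case True
    then show ?thesis using \<alpha>[OF True T(1-3) refl T(4)] by (simp add: split_value_def)
  next
    case False
    have "{x j, x k} \<in> edges \<T>" using T by (auto simp: edges_def)
    then obtain T' where T': "{T \<in> \<T>. {x j, x k} \<in> sides T} = {T'}"
      using boundary_edge_triangle False by blast
    then have "T' = T" using T by blast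
    then show ?thesis using total[OF T(1,4,2,3)] T' False by (simp add: split_value_def)
  qed
  then show ?thesis by blast
qed

lemma off_diagonal_of_operators:
  assumes \<sigma>: "\<sigma> \<in> PC \<Omega> \<T>" and B: "B \<le> N"
    and inv: "invertible_mat (network_matrix \<T> N B x \<gamma>)"
    and mat: "fem_matrix \<Omega> \<T> N B x \<sigma> = network_matrix \<T> N B x \<gamma>"
    and DN: "\<And>f. f \<in> carrier_vec B \<Longrightarrow> fem_DN \<Omega> \<T> N B x \<sigma> f = network_DN \<T> N B x \<gamma> f"
    and jk: "j < N" "k < N"
  shows "stiffness \<Omega> \<T> N x \<Omega> \<sigma> j k = network_laplacian \<T> N x \<gamma> j k"
proof -
  define S where "S = stiffness \<Omega> \<T> N x \<Omega> \<sigma>"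
  define K where "K = network_laplacian \<T> N x \<gamma>"
  have S_commute: "S j k = S k j" if "j < N" "k < N" for j k
    using that stiffness_commute[OF \<sigma>] by (simp add: S_def stiffness_sum[OF \<sigma>])
  have K_commute: "K j k = K k j" for j k
    unfolding K_def by (rule network_laplacian_commute)
  have int: "S j k = K j k" if "B \<le> j" "j < N" "k < N" for j k
  proof -
    have "fem_matrix \<Omega> \<T> N B x \<sigma> $$ (j, k) = network_matrix \<T> N B x \<gamma> $$ (j, k)" by (simp add: mat)
    then show ?thesis
      using that by (simp add: fem_matrix_def network_matrix_def S_def K_def network_laplacian_def)
  qed
  have bdry: "S j k = K j k" if "j < B" "k < B" for j k
  proof -
    \<comment> \<open>Both Dirichlet problems have the same matrix, so one solution \<open>u\<close>
      serves both maps.\<close>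
    define u where "u = dirichlet_solution N B (network_matrix \<T> N B x \<gamma>) (unit_vec B k)"
    have u: "u $ i = of_bool (i = k)" if "i < B" for i
    proof -
      have "u $ i = unit_vec B k $ i"
        unfolding u_def
      proof (rule dirichlet_solution_boundary[OF _ inv B])
        show "network_matrix \<T> N B x \<gamma> \<in> carrier_mat N N" by (simp add: network_matrix_def)
        show "row (network_matrix \<T> N B x \<gamma>) j = unit_vec N j" if "j < B" for j
          using that B by (intro eq_vecI) (auto simp: network_matrix_def unit_vec_def)
      qed (use that in auto)
      then show ?thesis using that \<open>k < B\<close> by (simp add: unit_vec_def)
    qed
    have "fem_DN \<Omega> \<T> N B x \<sigma> (unit_vec B k) $ j = network_DN \<T> N B x \<gamma> (unit_vec B k) $ j"
      by (simp add: DN)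
    then have "(\<Sum>k<N. S j k * u $ k) = (\<Sum>k<N. K j k * u $ k)"
      using that B by (simp add: fem_DN_def network_DN_def mat network_laplacian_mult
          flip: S_def K_def u_def)
    then have "0 = (\<Sum>k<N. (S j k - K j k) * u $ k)"
      by (simp add: left_diff_distrib sum_subtractf)
    \<comment> \<open>The interior values of \<open>u\<close> are unknown, but their coefficients
      vanish: by symmetry these entries lie in rows already compared.\<close>
    also have "\<dots> = (\<Sum>i<B. (S j i - K j i) * u $ i)"
    proof (rule sum.mono_neutral_right)
      show "\<forall>i\<in>{..<N} - {..<B}. (S j i - K j i) * u $ i = 0"
        using int S_commute K_commute that(1) B by (auto simp: not_less)
    qed (use B in auto)
    also have "\<dots> = (\<Sum>i<B. if i = k then S j k - K j k else 0)"
      by (intro sum.cong) (auto simp: u)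
    finally show ?thesis using that(2) by simp
  qed
  consider "B \<le> j" | "B \<le> k" | "j < B" "k < B" by linarith
  then have "S j k = K j k"
    using int[of j k] int[of k j] bdry jk S_commute[of j k] K_commute[of j k] by cases auto
  then show ?thesis by (simp add: S_def K_def)
qed

end

theorem theorem1p2:
  fixes \<Omega> :: "(real^2) set" and \<T> :: "(real^2) set set"
    and N B :: nat and x :: "nat \<Rightarrow> real^2"
    and \<gamma> :: "(real^2) set \<Rightarrow> real"
    and d :: "(real^2) set \<Rightarrow> (real^2) \<times> (real^2)"
  assumes polygon: "interior_of_simple_polygon \<Omega>"
    and triangulation: "triangulates \<T> (closure \<Omega>)"
    and labels: "bij_betw x {..<N} (vertices \<T>)"
    and boundary_labels: "B \<le> N" "x ` {..<B} = vertices \<T> \<inter> frontier \<Omega>"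
    and not_eigenvalue: "invertible_mat (network_matrix \<T> N B x \<gamma>)"
    and orientations: "\<And>e. e \<in> interior_edges \<T> \<Longrightarrow> {fst (d e), snd (d e)} = e"
  shows "\<exists>\<Sigma> :: ((real^2) set \<Rightarrow> real) \<Rightarrow> (real^2 \<Rightarrow> real^2^2).
     (\<forall>\<alpha>. \<Sigma> \<alpha> \<in> PC \<Omega> \<T> \<and>
          splits_interior \<Omega> \<T> N x \<gamma> d \<alpha> (\<Sigma> \<alpha>) \<and>
          splits_boundary \<Omega> \<T> N x \<gamma> (\<Sigma> \<alpha>) \<and>
          fem_matrix \<Omega> \<T> N B x (\<Sigma> \<alpha>) = network_matrix \<T> N B x \<gamma> \<and>
          (\<forall>f\<in>carrier_vec B. fem_DN \<Omega> \<T> N B x (\<Sigma> \<alpha>) f = network_DN \<T> N B x \<gamma> f)) \<and>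
     (\<forall>\<sigma>\<in>PC \<Omega> \<T>.
          fem_matrix \<Omega> \<T> N B x \<sigma> = network_matrix \<T> N B x \<gamma> \<and>
          (\<forall>f\<in>carrier_vec B. fem_DN \<Omega> \<T> N B x \<sigma> f = network_DN \<T> N B x \<gamma> f) \<longrightarrow>
          (\<exists>\<alpha>. AE y in lebesgue_on \<Omega>. \<sigma> y = \<Sigma> \<alpha> y))"
proof -
  interpret polygon_triangulation \<Omega> \<T> N x
    by unfold_locales (fact triangulation labels polygon)+
  have "\<forall>\<alpha>. \<exists>\<sigma>. \<sigma> \<in> PC \<Omega> \<T> \<and> (\<forall>T\<in>\<T>. \<forall>j<N. \<forall>k<N. {x j, x k} \<in> sides T \<longrightarrow>
      stiffness \<Omega> \<T> N x T \<sigma> j k = split_value \<T> \<gamma> d \<alpha> T {x j, x k})"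
    using PC_prescribed_stiffness by blast
  then obtain \<Sigma> where \<Sigma>: "\<And>\<alpha>. \<Sigma> \<alpha> \<in> PC \<Omega> \<T>"
      "\<And>\<alpha> T j k. T \<in> \<T> \<Longrightarrow> j < N \<Longrightarrow> k < N \<Longrightarrow> {x j, x k} \<in> sides T \<Longrightarrow>
        stiffness \<Omega> \<T> N x T (\<Sigma> \<alpha>) j k = split_value \<T> \<gamma> d \<alpha> T {x j, x k}"
    by metis
  note split = split_stiffness[OF \<Sigma>(1) orientations \<Sigma>(2)]
  show ?thesis
  proof (intro exI[of _ \<Sigma>] conjI allI ballI impI)
    fix \<alpha> f
    show "\<Sigma> \<alpha> \<in> PC \<Omega> \<T>" by (rule \<Sigma>(1))
    show "splits_interior \<Omega> \<T> N x \<gamma> d \<alpha> (\<Sigma> \<alpha>)" "splits_boundary \<Omega> \<T> N x \<gamma> (\<Sigma> \<alpha>)"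
      by (rule split(1); assumption) (rule split(2); assumption)
    show "fem_matrix \<Omega> \<T> N B x (\<Sigma> \<alpha>) = network_matrix \<T> N B x \<gamma>"
      "fem_DN \<Omega> \<T> N B x (\<Sigma> \<alpha>) f = network_DN \<T> N B x \<gamma> f"
      by (rule same_operators[OF boundary_labels(1) split(3)]; assumption)+
  next
    fix \<sigma>
    assume \<sigma>: "\<sigma> \<in> PC \<Omega> \<T>" and eq: "fem_matrix \<Omega> \<T> N B x \<sigma> = network_matrix \<T> N B x \<gamma> \<and>
      (\<forall>f\<in>carrier_vec B. fem_DN \<Omega> \<T> N B x \<sigma> f = network_DN \<T> N B x \<gamma> f)"
    then have "stiffness \<Omega> \<T> N x \<Omega> \<sigma> j k = network_laplacian \<T> N x \<gamma> j k" if "j < N" "k < N" for j k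
      using off_diagonal_of_operators[OF \<sigma> boundary_labels(1) not_eigenvalue _ _ that] by blast
    then have "stiffness \<Omega> \<T> N x \<Omega> \<sigma> j k = - conductance \<T> x \<gamma> j k" if "j < N" "k < N" "j \<noteq> k" for j k
      using that by (simp add: network_laplacian_def)
    then obtain \<alpha> where "\<And>T j k. T \<in> \<T> \<Longrightarrow> j < N \<Longrightarrow> k < N \<Longrightarrow> {x j, x k} \<in> sides T \<Longrightarrow>
        stiffness \<Omega> \<T> N x T \<sigma> j k = split_value \<T> \<gamma> d \<alpha> T {x j, x k}"
      using stiffness_split_exists[OF \<sigma> orientations, of \<gamma>] by metis
    \<comment> \<open>Both functions have the side integrals given by \<open>split_value\<close>,
      and these determine an element of \<open>PC\<close> almost everywhere.\<close>
    then have "AE y in lebesgue_on \<Omega>. \<sigma> y = \<Sigma> \<alpha> y"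
      by (intro PC_eqI[OF \<sigma> \<Sigma>(1)]) (simp add: \<Sigma>(2))
    then show "\<exists>\<alpha>. AE y in lebesgue_on \<Omega>. \<sigma> y = \<Sigma> \<alpha> y" by blast
  qed
qed

end
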